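(* Let $a,b,c$ be integers, let $Q(x,y,z)=ax^2+by^2+cz^2$, and let $p$ be an odd prime. Suppose $p\nmid a$, $b=b_0p^{b_1}$ and $c=c_0p^{c_1}$ with integers $0\le b_1\le c_1$, $\gcd(b_0,p)=1$ and $\gcd(c_0,p)=1$. Let $m$ be a nonzero integer with $m=m_0p^{m_1}$, $\gcd(m_0,p)=1$, $m_1\ge 0$. Then: (1) If $m_1<b_1$, then $$\alpha_p(m,Q)=\begin{cases} p^{m_1/2}\left(1+\left(\frac{am_0}{p}\right)\right), & m_1 \text{ even},\\ 0, & m_1\text{ odd}.\end{cases}$$ (2) If $b_1\le m_1<c_1$, then $$\alpha_p(m,Q)=\begin{cases} p^{b_1/2}\Big(1-\frac1p\left(\frac{-ab_0}{p}\right)^{m_1+1}+\left(1-\frac1p\right)\Big(\frac{m_1-b_1}{2}+\frac{(-1)^{m_1}-1}{4}+\left(\frac{-ab_0}{p}\right)\Big(\frac{m_1-b_1}{2}+\frac{1-(-1)^{m_1}}{4}\Big)\Big)\Big), & b_1\text{ even},\\ p^{(b_1-1)/2}\left(1+\left(\frac{a}{p}\right)^{m_1+1}\left(\frac{b_0}{p}\right)^{m_1}\left(\frac{m_0}{p}\right)\right), & b_1\text{ odd}.\end{cases}$$ (3) If $m_1\ge c_1$ and $b_1$ is even, then $\alpha_p(m,Q)$ equals: - if $c_1$ and $m_1$ are even: $p^{b_1/2}\Big(1+\frac1p+p^{-m_1/2+c_1/2-1}\big(\left(\frac{-ab_0c_0m_0}{p}\right)-1\big)+\left(1-\frac1p\right)\Big(\frac{c_1-b_1}{2}+\left(\frac{-ab_0}{p}\right)\frac{c_1-b_1}{2}\Big)\Big)$;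 - if $c_1$ is even and $m_1$ is odd: $p^{b_1/2}\Big(\left(1+\frac1p\right)\left(1-p^{-(m_1+1)/2+c_1/2}\right)+\left(1-\frac1p\right)\Big(\frac{c_1-b_1}{2}+\left(\frac{-ab_0}{p}\right)\frac{c_1-b_1}{2}\Big)\Big)$; - if $c_1$ is odd and $m_1$ is even: $p^{b_1/2}\Big(1-p^{-m_1/2+(c_1-1)/2}\left(\frac{-ab_0}{p}\right)\left(1+\frac1p\right)+\frac1p\left(\frac{-ab_0}{p}\right)+\left(1-\frac1p\right)\Big(\frac{c_1-b_1-1}{2}+\left(\frac{-ab_0}{p}\right)\frac{c_1-b_1+1}{2}\Big)\Big)$; - if $c_1$ and $m_1$ are odd: $p^{b_1/2}\Big(1+p^{-(m_1+1)/2+(c_1-1)/2}\big(\left(\frac{c_0m_0}{p}\right)-\left(\frac{-ab_0}{p}\right)\big)+\frac1p\left(\frac{-ab_0}{p}\right)+\left(1-\frac1p\right)\Big(\frac{c_1-b_1-1}{2}+\left(\frac{-ab_0}{p}\right)\frac{c_1-b_1+1}{2}\Big)\Big)$. (4) If $m_1\ge c_1$ and $b_1$ is odd, then $\alpha_p(m,Q)$ equals: - if $c_1$ and $m_1$ are even: $p^{(b_1-1)/2}\Big(1+\left(\frac{-ac_0}{p}\right)-p^{-m_1/2+c_1/2}\left(1+\frac1p\right)\left(\frac{-ac_0}{p}\right)\Big)$; - if $c_1$ is even and $m_1$ is odd: $p^{(b_1-1)/2}\Big(1+\left(\frac{-ac_0}{p}\right)+p^{-(m_1+1)/2+c_1/2}\big(\left(\frac{b_0m_0}{p}\right)-\left(\frac{-ac_0}{p}\right)\big)\Big)$;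 - if $c_1$ is odd and $m_1$ is even: $p^{(b_1-1)/2}\Big(1+\left(\frac{-b_0c_0}{p}\right)+p^{-m_1/2+(c_1-1)/2}\big(\left(\frac{am_0}{p}\right)-\left(\frac{-b_0c_0}{p}\right)\big)\Big)$; - if $c_1$ and $m_1$ are odd: $p^{(b_1-1)/2}\Big(1+\left(\frac{-b_0c_0}{p}\right)-p^{(-m_1+c_1)/2}\left(1+\frac1p\right)\left(\frac{-b_0c_0}{p}\right)\Big)$. (5) Furthermore, $$\alpha_p(0,Q)=\begin{cases} p^{b_1/2}\Big(1+\frac1p+\left(1-\frac1p\right)\Big(\frac{c_1-b_1}{2}+\left(\frac{-ab_0}{p}\right)\frac{c_1-b_1}{2}\Big)\Big), & b_1,c_1\text{ even},\\ p^{b_1/2}\Big(1+\frac1p\left(\frac{-ab_0}{p}\right)+\left(1-\frac1p\right)\Big(\frac{c_1-b_1-1}{2}+\left(\frac{-ab_0}{p}\right)\frac{c_1-b_1+1}{2}\Big)\Big), & b_1\text{ even}, c_1\text{ odd},\\ p^{(b_1-1)/2}\left(1+\left(\frac{-ac_0}{p}\right)\right), & b_1\text{ odd}, c_1\text{ even},\\ p^{(b_1-1)/2}\left(1+\left(\frac{-b_0c_0}{p}\right)\right), & b_1,c_1\text{ odd}.\end{cases}$$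
   Context: $\left(\frac{\cdot}{p}\right)$ denotes the Legendre symbol. For a positive integer $n$ and integer $m$, $r_n(m,Q)=\#\{v\in(\mathbb Z/n\mathbb Z)^3: Q(v)\equiv m \pmod n\}$. The local density at the prime $p$ is $\alpha_p(m,Q)=\lim_{U\to\{m\}}\mathrm{Vol}_{\mathbb Z_p^3}(Q^{-1}(U))/\mathrm{Vol}_{\mathbb Z_p}(U)$, where $U$ runs over a sequence of open subsets of $\mathbb Z_p$ shrinking to $m$ and volumes are with respect to Haar measure; equivalently $\alpha_p(m,Q)=\lim_{k\to\infty} r_{p^k}(m,Q)/p^{2k}$. *)

theory Defs
  imports Complex_Main "HOL-Number_Theory.Number_Theory"
begin

definition diag_form :: "int \<Rightarrow> int \<Rightarrow> int \<Rightarrow> int \<times> int \<times> int \<Rightarrow> int" where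
  "diag_form a b c = (\<lambda>(x, y, z). a * x\<^sup>2 + b * y\<^sup>2 + c * z\<^sup>2)"

text \<open>
  Elements of $(\mathbb{Z}/n\mathbb{Z})^3$ are represented by triples with entries in
  $\{0,\dots,n-1\}$; this is meaningful for \<open>Q\<close> given by an integral polynomial.
\<close>

definition rep_count :: "nat \<Rightarrow> int \<Rightarrow> (int \<times> int \<times> int \<Rightarrow> int) \<Rightarrow> nat" where
  "rep_count n m Q =
     card {v \<in> {0..<int n} \<times> {0..<int n} \<times> {0..<int n}. [Q v = m] (mod int n)}"

text \<open>
  \<open>has_local_density p m Q d\<close> says that the limit defining $\alpha_p(m,Q)$ exists and equals
  \<open>d\<close>. The term with index \<open>k\<close> is $\mathrm{Vol}(Q^{-1}(U))/\mathrm{Vol}(U)$ for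
  $U = m + p^k\mathbb{Z}_p$: here $\mathrm{Vol}(U) = p^{-k}$, and $Q^{-1}(U)$ is a union of
  $r_{p^k}(m,Q)$ cosets of $p^k\mathbb{Z}_p^3$, each of volume $p^{-3k}$.
\<close>

definition has_local_density :: "nat \<Rightarrow> int \<Rightarrow> (int \<times> int \<times> int \<Rightarrow> int) \<Rightarrow> real \<Rightarrow> bool" where
  "has_local_density p m Q d \<longleftrightarrow>
     (\<lambda>k. real (rep_count (p ^ k) m Q) / real p ^ (2 * k)) \<longlonglongrightarrow> d"

abbreviation leg :: "int \<Rightarrow> nat \<Rightarrow> real" where
  "leg x p \<equiv> real_of_int (Legendre x (int p))"

end

theory Submission
  imports Defs
begin

text \<open>
  For a unit \<open>a\<close>, split the solutions of \<open>Q \<equiv> m\<close> modulo \<open>p ^ k\<close> according to whether \<open>x\<close> is a unit.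
  By Hensel's lemma the unit part is the same for all \<open>k \<ge> 1\<close> and is a Legendre symbol sum over the
  residue field; in the remaining part \<open>x = p x'\<close>, which turns \<open>a\<close> into \<open>p\<^sup>2 a\<close>. Splitting off all
  variables with unit coefficients and dividing by \<open>p\<close> gives a descent in the \<open>p\<close>-adic valuations of
  \<open>b\<close>, \<open>c\<close> and \<open>m\<close>. It lowers \<open>(b\<^sub>1, c\<^sub>1)\<close> to \<open>(0, 0)\<close>, \<open>(0, 1)\<close>, \<open>(1, 0)\<close> or \<open>(1, 1)\<close>, unless \<open>m\<close>
  becomes a unit or \<open>p\<close> times a unit earlier. These last forms reproduce themselves under
  \<open>p\<^sup>2 m \<mapsto> m\<close>, the density being contracted by \<open>1 / p\<close> towards a fixed point, which is the density
  at \<open>0\<close>.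
\<close>

subsection \<open>Periodic sums\<close>

text \<open>The interval splits into \<open>e\<close> blocks, each a translate of the first by a
  multiple of \<open>d\<close>. This serves sums over residues modulo \<open>p ^ Suc k\<close> whose
  summand depends only on residues modulo a smaller power of \<open>p\<close>.\<close>

lemma sum_periodic_mult:
  fixes f :: "int \<Rightarrow> real"
  assumes per: "\<And>x y. d dvd x - y \<Longrightarrow> f x = f y" and "d \<ge> 0"
  shows "sum f {0..<d * int e} = real e * sum f {0..<d}"
proof (induction e)
  case (Suc e)
  have "{0..<d * int (Suc e)} = {0..<d * int e} \<union> {d * int e..<d * int e + d}"
    using ivl_disj_un_two(3)[of 0 "d * int e" "d * int e + d"] \<open>d \<ge> 0\<close>
    by (simp add: algebra_simps)
  then have "sum f {0..<d * int (Suc e)} = sum f {0..<d * int e} + sum f {d * int e..<d * int e + d}"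
    by (simp only:) (rule sum.union_disjoint, auto)
  also have "sum f {d * int e..<d * int e + d} = sum f {0..<d}"
    by (rule sum.reindex_bij_witness[of _ "\<lambda>x. x + d * int e" "\<lambda>x. x - d * int e"])
       (auto intro: per)
  finally show ?case
    using Suc by (simp add: algebra_simps)
qed simp

text \<open>An injection of the finitely many residues modulo \<open>d\<close> permutes them. As
  \<open>h\<close> itself may leave the interval, it is followed by \<open>mod d\<close>, which does
  not change the value of \<open>f\<close>.\<close>

lemma sum_periodic_reindex:
  fixes f :: "int \<Rightarrow> real"
  assumes per: "\<And>x y. d dvd x - y \<Longrightarrow> f x = f y" and "d > 0"
    and inj: "\<And>x y. d dvd h x - h y \<Longrightarrow> d dvd x - y"
  shows "(\<Sum>x\<in>{0..<d}. f (h x)) = sum f {0..<d}"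
proof -
  have "inj_on (\<lambda>x. h x mod d) {0..<d}"
  proof (rule inj_onI)
    fix x y assume xy: "x \<in> {0..<d}" "y \<in> {0..<d}" "h x mod d = h y mod d"
    then have "d dvd x - y"
      by - (rule inj, simp add: mod_eq_dvd_iff)
    then show "x = y"
      using xy by (metis atLeastLessThan_iff mod_eq_dvd_iff mod_pos_pos_trivial)
  qed
  moreover have "(\<lambda>x. h x mod d) ` {0..<d} \<subseteq> {0..<d}"
    using \<open>d > 0\<close> by auto
  ultimately have bij: "bij_betw (\<lambda>x. h x mod d) {0..<d} {0..<d}"
    by (simp add: bij_betw_def endo_inj_surj)
  have "(\<Sum>x\<in>{0..<d}. f (h x)) = (\<Sum>x\<in>{0..<d}. f (h x mod d))"
    by (intro sum.cong refl per) (simp add: mod_eq_dvd_iff [symmetric])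
  also have "\<dots> = sum f {0..<d}"
    by (rule sum.reindex_bij_betw[OF bij])
  finally show ?thesis .
qed

lemma card_eq_sum_of_bool:
  assumes "finite A"
  shows "real (card {x \<in> A. P x}) = (\<Sum>x\<in>A. of_bool (P x))"
  using assms by (simp add: Int_def of_bool_def sum.If_cases)

lemma sum_periodic_mult2:
  fixes f :: "int \<Rightarrow> int \<Rightarrow> real"
  assumes per: "\<And>x y x' y'. d dvd x - x' \<Longrightarrow> d dvd y - y' \<Longrightarrow> f x y = f x' y'" and "d \<ge> 0"
  shows "(\<Sum>x\<in>{0..<d * int e}. \<Sum>y\<in>{0..<d * int e}. f x y)
    = real e ^ 2 * (\<Sum>x\<in>{0..<d}. \<Sum>y\<in>{0..<d}. f x y)"
proof -
  have "(\<Sum>y\<in>{0..<d * int e}. f x y) = real e * (\<Sum>y\<in>{0..<d}. f x y)" for x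
    using \<open>d \<ge> 0\<close> by (intro sum_periodic_mult per) auto
  moreover have "(\<Sum>x\<in>{0..<d * int e}. \<Sum>y\<in>{0..<d}. f x y) = real e * (\<Sum>x\<in>{0..<d}. \<Sum>y\<in>{0..<d}. f x y)"
    using \<open>d \<ge> 0\<close> by (intro sum_periodic_mult sum.cong refl per) auto
  ultimately show ?thesis
    by (simp add: sum_distrib_left[symmetric] power2_eq_square)
qed

lemma sum_periodic_mult3:
  fixes f :: "int \<Rightarrow> int \<Rightarrow> int \<Rightarrow> real"
  assumes per: "\<And>x y z x' y' z'. d dvd x - x' \<Longrightarrow> d dvd y - y' \<Longrightarrow> d dvd z - z' \<Longrightarrow> f x y z = f x' y' z'"
    and "d \<ge> 0"
  shows "(\<Sum>x\<in>{0..<d * int e}. \<Sum>y\<in>{0..<d * int e}. \<Sum>z\<in>{0..<d * int e}. f x y z)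
    = real e ^ 3 * (\<Sum>x\<in>{0..<d}. \<Sum>y\<in>{0..<d}. \<Sum>z\<in>{0..<d}. f x y z)"
proof -
  have "(\<Sum>y\<in>{0..<d * int e}. \<Sum>z\<in>{0..<d * int e}. f x y z)
      = real e ^ 2 * (\<Sum>y\<in>{0..<d}. \<Sum>z\<in>{0..<d}. f x y z)" for x
    using \<open>d \<ge> 0\<close> by (intro sum_periodic_mult2 per) auto
  moreover have "(\<Sum>x\<in>{0..<d * int e}. \<Sum>y\<in>{0..<d}. \<Sum>z\<in>{0..<d}. f x y z)
      = real e * (\<Sum>x\<in>{0..<d}. \<Sum>y\<in>{0..<d}. \<Sum>z\<in>{0..<d}. f x y z)"
    using \<open>d \<ge> 0\<close> by (intro sum_periodic_mult sum.cong refl per) auto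
  ultimately show ?thesis
    by (simp add: sum_distrib_left[symmetric] power2_eq_square power3_eq_cube)
qed

lemma dvd_square_diff: "(d :: int) dvd x - y \<Longrightarrow> d dvd a * x\<^sup>2 - a * y\<^sup>2"
  using dvd_mult[of d "x - y" "a * (x + y)"] by (simp add: algebra_simps power2_eq_square)

text \<open>A recursion that raises the level by two controls the even and the odd levels
  separately; this glues the two limits together.\<close>

lemma LIMSEQ_even_odd:
  fixes f :: "nat \<Rightarrow> 'a :: topological_space"
  assumes "(\<lambda>n. f (2 * n)) \<longlonglongrightarrow> l" "(\<lambda>n. f (2 * n + 1)) \<longlonglongrightarrow> l"
  shows "f \<longlonglongrightarrow> l"
proof (rule topological_tendstoI)
  fix S assume S: "open S" "l \<in> S"
  obtain M N where "\<And>n. n \<ge> M \<Longrightarrow> f (2 * n) \<in> S" "\<And>n. n \<ge> N \<Longrightarrow> f (2 * n + 1) \<in> S"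
    using assms[THEN topological_tendstoD, OF S] unfolding eventually_sequentially by blast
  then have "f n \<in> S" if "n \<ge> 2 * (M + N) + 1" for n
    using that by (cases "even n") (auto elim!: evenE oddE)
  then show "\<forall>\<^sub>F n in sequentially. f n \<in> S"
    by (auto simp: eventually_sequentially)
qed

subsection \<open>Legendre symbols modulo an odd prime\<close>

locale odd_prime =
  fixes p :: nat
  assumes prime_p: "prime p" and odd_p: "odd p"
begin

lemma p_gt_2: "2 < p"
  using prime_ge_2_nat[OF prime_p] odd_p by (cases "p = 2") auto

lemma p_pos: "0 < p"
  using p_gt_2 by auto

lemma prime_int_p: "prime (int p)"
  using prime_p by simp

lemma p_dvd_mult_iff [simp]: "int p dvd x * y \<longleftrightarrow> int p dvd x \<or> int p dvd y"
  using prime_int_p by (rule prime_dvd_mult_iff)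

lemma p_dvd_power_iff [simp]: "int p dvd x\<^sup>2 \<longleftrightarrow> int p dvd x"
  by (simp add: power2_eq_square)

lemma not_p_dvd_2 [simp]: "\<not> int p dvd 2"
  using p_gt_2 by (auto dest: zdvd_imp_le)

lemma not_p_dvd_1 [simp]: "\<not> int p dvd 1"
  using p_gt_2 by (auto dest: zdvd_imp_le)

lemma p_dvd_uminus_mult [simp]: "int p dvd - x * y \<longleftrightarrow> int p dvd x \<or> int p dvd y"
  by (metis mult_minus_left dvd_minus_iff p_dvd_mult_iff)

lemma coprime_p_iff: "coprime x (int p) \<longleftrightarrow> \<not> int p dvd x"
  using prime_imp_coprime[OF prime_int_p, of x] coprime_common_divisor[of x "int p" "int p"]
    prime_int_p by (auto simp: coprime_commute)

lemma inverse_mod_p: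
  assumes "\<not> int p dvd u"
  obtains v where "int p dvd u * v - 1"
  using cong_solve_coprime_int[of u "int p"] assms by (auto simp: coprime_p_iff cong_iff_dvd_diff)

lemma p_dvd_iff_of_diff: "int p dvd x - y \<Longrightarrow> int p dvd x \<longleftrightarrow> int p dvd y"
  using dvd_add_right_iff[of "int p" "x - y" y] by simp

lemma Legendre_cong:
  assumes "int p dvd x - y"
  shows "Legendre x (int p) = Legendre y (int p)"
proof -
  have "[x = y] (mod int p)" "[y = x] (mod int p)"
    using assms by (simp_all add: cong_iff_dvd_diff dvd_diff_commute)
  then show ?thesis
    unfolding Legendre_def QuadRes_def by (smt (verit, best) cong_trans)
qed

lemma Legendre_eq_0 [simp]: "int p dvd x \<Longrightarrow> Legendre x (int p) = 0"
  by (simp add: Legendre_def cong_0_iff)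

lemma Legendre_cases: "Legendre x (int p) \<in> {-1, 0, 1}"
  by (simp add: Legendre_def)

text \<open>Euler's criterion gives the identity modulo \<open>p\<close>. Both sides lie in {-1, 0,
  1}, so they differ by at most 2, which is less than \<open>p\<close>.\<close>

lemma Legendre_mult: "Legendre (x * y) (int p) = Legendre x (int p) * Legendre y (int p)"
proof -
  let ?L = "\<lambda>x. Legendre x (int p)"
  have E: "[?L x = x ^ ((p - 1) div 2)] (mod int p)" for x
    using euler_criterion[OF prime_p p_gt_2] .
  have "[?L (x * y) = ?L x * ?L y] (mod int p)"
    using cong_trans[OF E[of "x * y"] cong_sym[OF cong_mult[OF E[of x] E[of y], folded power_mult_distrib]]] .
  then have "int p dvd ?L (x * y) - ?L x * ?L y"
    by (simp add: cong_iff_dvd_diff)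
  moreover have "\<bar>?L (x * y) - ?L x * ?L y\<bar> \<le> 2"
    using Legendre_cases[of "x * y"] Legendre_cases[of x] Legendre_cases[of y] by auto
  ultimately have "?L (x * y) - ?L x * ?L y = 0"
    using p_gt_2 dvd_imp_le_int[of "?L (x * y) - ?L x * ?L y" "int p"] by fastforce
  then show ?thesis by simp
qed

lemma Legendre_square: "\<not> int p dvd x \<Longrightarrow> Legendre (x\<^sup>2) (int p) = 1"
  by (auto simp: Legendre_def cong_0_iff QuadRes_def intro!: exI[of _ x])

lemma leg_square [simp]: "\<not> int p dvd x \<Longrightarrow> leg x p * leg x p = 1"
  by (metis Legendre_mult Legendre_square of_int_1 of_int_mult power2_eq_square)

subsection \<open>Roots of quadratic congruences\<close>

text \<open>
  The number of units \<open>x\<close> modulo \<open>p ^ k\<close> with \<open>a * x\<^sup>2 \<equiv> n\<close>, for a unit \<open>a\<close> and any \<open>k \<ge> 1\<close>.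
\<close>
definition unit_roots :: "int \<Rightarrow> int \<Rightarrow> real" where
  "unit_roots a n = (if int p dvd n then 0 else 1 + leg (a * n) p)"

lemma unit_roots_cong: "int p dvd x - y \<Longrightarrow> unit_roots a x = unit_roots a y"
  using p_dvd_iff_of_diff[of x y] Legendre_cong[of "a * x" "a * y"]
  by (simp add: unit_roots_def right_diff_distrib[symmetric])

text \<open>Given one root \<open>x0\<close>, every root \<open>x\<close> makes
  \<open>a * (x - x0) * (x + x0)\<close> divisible by \<open>p\<close>, so the roots are
  \<open>x0\<close> and \<open>p - x0\<close>. Without roots and for a unit \<open>n\<close>, the
  symbol is -1, because a square root of \<open>a * n\<close> divided by \<open>a\<close> would be a
  root.\<close>

lemma card_unit_roots_mod_p:
  assumes a: "\<not> int p dvd a"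
  shows "real (card {x \<in> {0..<int p}. \<not> int p dvd x \<and> int p dvd a * x\<^sup>2 - n}) = unit_roots a n"
    (is "real (card ?S) = _")
proof (cases "?S = {}")
  case True
  have "Legendre (a * n) (int p) = -1" if n: "\<not> int p dvd n"
  proof -
    have "\<not> QuadRes (int p) (a * n)"
    proof
      assume "QuadRes (int p) (a * n)"
      then obtain y where y: "int p dvd y\<^sup>2 - a * n"
        by (auto simp: QuadRes_def cong_iff_dvd_diff)
      obtain v where v: "int p dvd a * v - 1"
        using inverse_mod_p[OF a] .
      define x where "x = (v * y) mod int p"
      have x: "int p dvd x - v * y"
        by (simp add: x_def mod_eq_dvd_iff[symmetric])
      \<comment> \<open>Here \<open>x\<close> represents \<open>y / a\<close>. Each of the three
        summands has a factor divisible by \<open>p\<close>: \<open>x - v * y\<close>,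
        \<open>y^2 - a * n\<close> and \<open>a * v - 1\<close>.\<close>
      have "a * x\<^sup>2 - n = a * (x + v * y) * (x - v * y) + a * v\<^sup>2 * (y\<^sup>2 - a * n)
          + n * (a * v + 1) * (a * v - 1)"
        by (simp add: algebra_simps power2_eq_square)
      then have 1: "int p dvd a * x\<^sup>2 - n"
        using x v y by (metis dvd_add dvd_mult)
      then have "\<not> int p dvd x"
        using n p_dvd_iff_of_diff[of "a * x\<^sup>2" n] by auto
      moreover have "x \<in> {0..<int p}"
        using p_pos by (simp add: x_def)
      ultimately show False
        using True 1 by auto
    qed
    then show ?thesis
      using a n by (simp add: Legendre_def cong_0_iff)
  qed
  then show ?thesis
    by (simp only: True) (simp add: unit_roots_def)
next
  case False
  then obtain x0 where x0: "0 \<le> x0" "x0 < int p" "\<not> int p dvd x0" "int p dvd a * x0\<^sup>2 - n"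
    by auto
  have n: "\<not> int p dvd n"
    using x0 p_dvd_iff_of_diff[of "a * x0\<^sup>2" n] a by auto
  have "?S = {x0, int p - x0}"
  proof (intro equalityI subsetI)
    fix x assume x: "x \<in> ?S"
    have "int p dvd (a * x\<^sup>2 - n) - (a * x0\<^sup>2 - n)"
      by (rule dvd_diff) (use x x0 in auto)
    also have "(a * x\<^sup>2 - n) - (a * x0\<^sup>2 - n) = a * ((x - x0) * (x + x0))"
      by (simp add: algebra_simps power2_eq_square)
    finally have "int p dvd x - x0 \<or> int p dvd x + x0"
      using a by simp
    then show "x \<in> {x0, int p - x0}"
    proof
      assume "int p dvd x - x0"
      then have "x = x0"
        using x x0 by (metis (no_types, lifting) mem_Collect_eq atLeastLessThan_iff mod_eq_dvd_iff mod_pos_pos_trivial)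
      then show ?thesis by simp
    next
      assume "int p dvd x + x0"
      then obtain j where j: "x + x0 = int p * j" ..
      moreover have "0 < x + x0" "x + x0 < int p * 2"
        using x x0 by (cases "x0 = 0", auto)
      ultimately have "j = 1"
        using p_pos by (auto simp: zero_less_mult_iff)
      then have "x = int p - x0"
        using j by simp
      then show ?thesis by simp
    qed
  next
    fix x assume "x \<in> {x0, int p - x0}"
    moreover have "0 < x0"
      using x0 by (cases "x0 = 0") auto
    moreover have "a * (int p - x0)\<^sup>2 - n = (a * x0\<^sup>2 - n) + int p * (a * (int p - 2 * x0))"
      by (simp add: algebra_simps power2_eq_square)
    then have "int p dvd a * (int p - x0)\<^sup>2 - n"
      using x0 by (simp only: dvd_add dvd_triv_left)
    ultimately show "x \<in> ?S"
      using x0 by (auto simp: dvd_diff_right_iff)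
  qed
  moreover have "x0 \<noteq> int p - x0"
    using odd_p by presburger
  ultimately have "card ?S = 2"
    by simp
  moreover have "QuadRes (int p) (a * n)"
  proof -
    have "(a * x0)\<^sup>2 - a * n = a * (a * x0\<^sup>2 - n)"
      by (simp add: algebra_simps power2_eq_square)
    then show ?thesis
      using x0 unfolding QuadRes_def cong_iff_dvd_diff by (metis dvd_mult)
  qed
  ultimately show ?thesis
    using a n by (simp add: unit_roots_def Legendre_def cong_0_iff)
qed

text \<open>Hensel lifting: reduction modulo \<open>q = p ^ Suc k\<close> is a bijection between the
  unit roots at successive levels, so the count modulo \<open>p\<close> persists.\<close>

lemma card_unit_roots:
  assumes a: "\<not> int p dvd a"
  shows "real (card {x \<in> {0..<int p ^ Suc k}. \<not> int p dvd x \<and> int p ^ Suc k dvd a * x\<^sup>2 - n})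
    = unit_roots a n"
proof (induction k)
  case 0
  then show ?case
    using card_unit_roots_mod_p[OF a] by simp
next
  case (Suc k)
  define q where "q = int p ^ Suc k"
  have q: "q > 0" and pq: "int p dvd q"
    using p_pos by (auto simp: q_def)
  let ?S = "{x \<in> {0..<q}. \<not> int p dvd x \<and> q dvd a * x\<^sup>2 - n}"
  let ?T = "{x \<in> {0..<int p * q}. \<not> int p dvd x \<and> int p * q dvd a * x\<^sup>2 - n}"
  have dvd_q: "q dvd a * (x mod q)\<^sup>2 - n \<longleftrightarrow> q dvd a * x\<^sup>2 - n" for x
    by (metis mod_eq_dvd_iff mod_mult_right_eq power_mod)
  have dvd_p: "int p dvd x mod q \<longleftrightarrow> int p dvd x" for x
    using pq by (simp add: dvd_mod_iff)
  have "bij_betw (\<lambda>x. x mod q) ?T ?S"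
  proof (rule bij_betwI')
    fix x y assume x: "x \<in> ?T" and y: "y \<in> ?T"
    show "x mod q = y mod q \<longleftrightarrow> x = y"
    proof
      assume "x mod q = y mod q"
      then have xy: "q dvd x - y"
        by (simp add: mod_eq_dvd_iff)
      \<comment> \<open>\<open>x + y\<close> is congruent to \<open>2 * x\<close>, a unit because
        \<open>p\<close> is odd. Hence \<open>a * (x + y)\<close> can be cancelled from
        \<open>p * q dvd a * (x + y) * (x - y)\<close>.\<close>
      then have "int p dvd (x + y) - 2 * x"
        using pq dvd_trans[of "int p" q "y - x"] by (simp add: dvd_diff_commute[of q x])
      then have "\<not> int p dvd a * (x + y)"
        using a x p_dvd_iff_of_diff[of "x + y" "2 * x"] by simp
      then have cop: "coprime (int p * q) (a * (x + y))"
        by (metis coprime_p_iff coprime_commute coprime_power_right_iff power_Suc q_def)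
      have "int p * q dvd (a * x\<^sup>2 - n) - (a * y\<^sup>2 - n)"
        by (rule dvd_diff) (use x y in auto)
      also have "(a * x\<^sup>2 - n) - (a * y\<^sup>2 - n) = (a * (x + y)) * (x - y)"
        by (simp add: algebra_simps power2_eq_square)
      finally have "int p * q dvd x - y"
        using cop by (simp add: coprime_dvd_mult_right_iff)
      then show "x = y"
        using x y by (metis (no_types, lifting) mem_Collect_eq atLeastLessThan_iff mod_eq_dvd_iff mod_pos_pos_trivial)
    qed simp
  next
    fix x assume "x \<in> ?T"
    then show "x mod q \<in> ?S"
      using q dvd_p dvd_q by (auto elim: dvd_mult_right)
  next
    fix y assume y: "y \<in> ?S"
    then obtain r where r: "a * y\<^sup>2 - n = q * r"
      by (auto elim: dvdE)
    obtain v where v: "int p dvd (2 * a * y) * v - 1"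
      using inverse_mod_p[of "2 * a * y"] y a by auto
    \<comment> \<open>Newton correction: modulo \<open>p * q\<close>, passing from \<open>y\<close>
      to \<open>y + q * t\<close> adds \<open>q * (2 * a * y * t)\<close> to
      \<open>a * y^2 - n = q * r\<close>. So \<open>2 * a * y * t\<close> has to be
      \<open>- r\<close> modulo \<open>p\<close>, and \<open>v\<close> inverts
      \<open>2 * a * y\<close>.\<close>
    define t where "t = (- r * v) mod int p"
    define x where "x = y + q * t"
    have t: "0 \<le> t" "t < int p" "int p dvd t + r * v"
      using p_pos mod_eq_dvd_iff[of t "int p" "- r * v"] by (auto simp: t_def)
    have "x \<ge> 0"
      using y t q by (auto simp: x_def)
    moreover have "x < int p * q"
    proof -
      have "x < q * (t + 1)"
        using y by (simp add: x_def algebra_simps)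
      also have "\<dots> \<le> q * int p"
        using t q by (intro mult_left_mono) auto
      finally show ?thesis by (simp add: mult.commute)
    qed
    moreover have xy: "x mod q = y"
      using y by (simp add: x_def)
    moreover have "\<not> int p dvd x"
      using y xy dvd_p[of x] by auto
    moreover have "int p * q dvd a * x\<^sup>2 - n"
    proof -
      have "a * x\<^sup>2 - n = (a * y\<^sup>2 - n) + q * (2 * a * y * t + a * q * t\<^sup>2)"
        by (simp add: x_def algebra_simps power2_eq_square)
      also have "\<dots> = q * (2 * a * y * (t + r * v) - r * (2 * a * y * v - 1) + q * (a * t\<^sup>2))"
        by (simp add: r algebra_simps)
      finally show ?thesis
        using t(3) v pq by (simp del: p_dvd_mult_iff add: mult.commute[of "int p"] dvd_add dvd_diff)
    qed
    ultimately show "\<exists>x\<in>?T. y = x mod q"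
      by (intro bexI[of _ x]) auto
  qed
  then have "card ?T = card ?S"
    by (rule bij_betw_same_card)
  then show ?case
    using Suc by (simp add: q_def)
qed

subsection \<open>Densities at finite level\<close>

definition root_count :: "nat \<Rightarrow> int \<Rightarrow> int \<Rightarrow> real" where
  "root_count k a n = (\<Sum>x\<in>{0..<int p ^ k}. of_bool (int p ^ k dvd a * x\<^sup>2 - n))"

text \<open>A root divisible by \<open>p\<close> has the form \<open>p * x\<close>, where
  \<open>x\<close> is a root for the coefficient \<open>p^2 * a\<close>. That congruence depends on
  \<open>x\<close> only modulo \<open>p ^ k\<close>, so \<open>root_count\<close> at level
  \<open>Suc k\<close> counts each such root \<open>p\<close> times; hence the division.\<close>

lemma root_count_split:
  assumes "\<not> int p dvd a"
  shows "root_count (Suc k) a n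
    = unit_roots a n + root_count (Suc k) (int p ^ 2 * a) n / real p"
proof -
  define q where "q = int p ^ k"
  have q: "q \<ge> 0" by (simp add: q_def)
  let ?D = "\<lambda>x. int p * q dvd a * x\<^sup>2 - n"
  have per: "int p * q dvd a * (int p * x)\<^sup>2 - n \<longleftrightarrow> int p * q dvd a * (int p * y)\<^sup>2 - n"
    if xy: "q dvd x - y" for x y
  proof -
    have "int p * q dvd a * (int p * x)\<^sup>2 - a * (int p * y)\<^sup>2"
      using xy by (intro dvd_square_diff) (simp flip: right_diff_distrib)
    then have "int p * q dvd (a * (int p * x)\<^sup>2 - n) - (a * (int p * y)\<^sup>2 - n)"
      by simp
    then show ?thesis
      by (metis diff_add_cancel dvd_add_right_iff)
  qed
  have "root_count (Suc k) (int p ^ 2 * a) n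
      = (\<Sum>x\<in>{0..<q * int p}. of_bool (int p * q dvd a * (int p * x)\<^sup>2 - n))"
    by (simp add: root_count_def q_def mult_ac power_mult_distrib)
  also have "\<dots> = real p * (\<Sum>x\<in>{0..<q}. of_bool (?D (int p * x)))"
    using per q by (intro sum_periodic_mult) auto
  also have "(\<Sum>x\<in>{0..<q}. of_bool (?D (int p * x)) :: real)
      = (\<Sum>x\<in>{x \<in> {0..<int p * q}. int p dvd x}. of_bool (?D x))"
    using p_pos by (intro sum.reindex_bij_witness[of _ "\<lambda>x. x div int p" "\<lambda>x. int p * x"])
      (auto elim!: dvdE simp: zero_le_mult_iff)
  finally have 1: "(\<Sum>x\<in>{x \<in> {0..<int p * q}. int p dvd x}. of_bool (?D x))
      = root_count (Suc k) (int p ^ 2 * a) n / real p"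
    using p_pos by simp
  have "unit_roots a n = (\<Sum>x\<in>{0..<int p * q}. of_bool (\<not> int p dvd x \<and> ?D x))"
    unfolding q_def card_unit_roots[OF assms, of k n, symmetric] by (subst card_eq_sum_of_bool) simp_all
  also have "\<dots> = (\<Sum>x\<in>{x \<in> {0..<int p * q}. \<not> int p dvd x}. of_bool (?D x))"
    by (intro sum.mono_neutral_cong_right) auto
  finally have 2: "(\<Sum>x\<in>{x \<in> {0..<int p * q}. \<not> int p dvd x}. of_bool (?D x)) = unit_roots a n" ..
  have "root_count (Suc k) a n = (\<Sum>x\<in>{0..<int p * q}. of_bool (?D x))"
    by (simp add: root_count_def q_def)
  also have "{0..<int p * q} = {x \<in> {0..<int p * q}. \<not> int p dvd x} \<union> {x \<in> {0..<int p * q}. int p dvd x}"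
    by auto
  also have "(\<Sum>x\<in>\<dots>. of_bool (?D x)) = (\<Sum>x\<in>{x \<in> {0..<int p * q}. \<not> int p dvd x}. of_bool (?D x) :: real)
      + (\<Sum>x\<in>{x \<in> {0..<int p * q}. int p dvd x}. of_bool (?D x))"
    by (rule sum.union_disjoint) (rule finite_subset[of _ "{0..<int p * q}"], auto)+
  finally show ?thesis
    using 1 2 by simp
qed

text \<open>Iterated sums of indicators, unlike a cardinality, allow exchanging the order of
  summation. The coefficients are separate arguments because the descent changes them
  independently.\<close>

definition dens :: "nat \<Rightarrow> int \<Rightarrow> int \<Rightarrow> int \<Rightarrow> int \<Rightarrow> real" where
  "dens k m a b c = (\<Sum>x\<in>{0..<int p ^ k}. \<Sum>y\<in>{0..<int p ^ k}. \<Sum>z\<in>{0..<int p ^ k}.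
     of_bool (int p ^ k dvd a * x\<^sup>2 + b * y\<^sup>2 + c * z\<^sup>2 - m)) / real p ^ (2 * k)"

lemma has_local_density_iff_dens:
  "has_local_density p m (diag_form a b c) d \<longleftrightarrow> (\<lambda>k. dens k m a b c) \<longlonglongrightarrow> d"
proof -
  have "real (rep_count (p ^ k) m (diag_form a b c)) = dens k m a b c * real p ^ (2 * k)" for k
    unfolding rep_count_def using p_pos
    by (subst card_eq_sum_of_bool)
       (simp_all add: dens_def sum.cartesian_product diag_form_def cong_iff_dvd_diff case_prod_unfold
         del: sum_of_bool_eq)
  then show ?thesis
    using p_pos by (simp add: has_local_density_def)
qed

lemma dens_swap12: "dens k m a b c = dens k m b a c"
  unfolding dens_def by (subst sum.swap) (simp add: add_ac)

lemma dens_swap23: "dens k m a b c = dens k m a c b"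
  unfolding dens_def by (subst (2) sum.swap) (simp add: add_ac)

text \<open>After division by \<open>p\<close> the congruence depends only on residues modulo
  \<open>p ^ k\<close>. Each solution then has \<open>p^3\<close> lifts, while the normalisation
  grows by \<open>p^2\<close> only.\<close>

lemma dens_Suc:
  "dens (Suc k) (int p * m) (int p * a) (int p * b) (int p * c) = real p * dens k m a b c"
proof -
  define q where "q = int p ^ k"
  have q: "q \<ge> 0" by (simp add: q_def)
  have *: "q * int p dvd int p * a * x\<^sup>2 + int p * b * y\<^sup>2 + int p * c * z\<^sup>2 - int p * m
      \<longleftrightarrow> q dvd a * x\<^sup>2 + b * y\<^sup>2 + c * z\<^sup>2 - m" for x y z
  proof -
    have "int p * a * x\<^sup>2 + int p * b * y\<^sup>2 + int p * c * z\<^sup>2 - int p * m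
        = int p * (a * x\<^sup>2 + b * y\<^sup>2 + c * z\<^sup>2 - m)"
      by (simp add: algebra_simps)
    then show ?thesis
      using p_pos by simp
  qed
  have per: "q dvd a * x\<^sup>2 + b * y\<^sup>2 + c * z\<^sup>2 - m \<longleftrightarrow> q dvd a * x'\<^sup>2 + b * y'\<^sup>2 + c * z'\<^sup>2 - m"
    if "q dvd x - x'" "q dvd y - y'" "q dvd z - z'" for x y z x' y' z'
  proof -
    have "q dvd (a * x\<^sup>2 - a * x'\<^sup>2) + (b * y\<^sup>2 - b * y'\<^sup>2) + (c * z\<^sup>2 - c * z'\<^sup>2)"
      using that by (intro dvd_add dvd_square_diff)
    also have "\<dots> = (a * x\<^sup>2 + b * y\<^sup>2 + c * z\<^sup>2 - m) - (a * x'\<^sup>2 + b * y'\<^sup>2 + c * z'\<^sup>2 - m)"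
      by simp
    finally show ?thesis
      by (metis diff_add_cancel dvd_add_right_iff)
  qed
  have "(\<Sum>x\<in>{0..<q * int p}. \<Sum>y\<in>{0..<q * int p}. \<Sum>z\<in>{0..<q * int p}.
      of_bool (q dvd a * x\<^sup>2 + b * y\<^sup>2 + c * z\<^sup>2 - m) :: real)
    = real p ^ 3 * (\<Sum>x\<in>{0..<q}. \<Sum>y\<in>{0..<q}. \<Sum>z\<in>{0..<q}.
      of_bool (q dvd a * x\<^sup>2 + b * y\<^sup>2 + c * z\<^sup>2 - m))"
    using q per by (intro sum_periodic_mult3) auto
  then show ?thesis
    using p_pos unfolding dens_def
    by (simp add: * q_def[symmetric] mult.commute[of "int p" q] power3_eq_cube del: sum_of_bool_eq)
qed

lemma dens_eq_0:
  assumes "int p dvd a" "int p dvd b" "int p dvd c" "\<not> int p dvd m"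
  shows "dens (Suc k) m a b c = 0"
proof -
  have "\<not> int p ^ Suc k dvd a * x\<^sup>2 + b * y\<^sup>2 + c * z\<^sup>2 - m" for x y z
  proof
    assume "int p ^ Suc k dvd a * x\<^sup>2 + b * y\<^sup>2 + c * z\<^sup>2 - m"
    then have "int p dvd a * x\<^sup>2 + b * y\<^sup>2 + c * z\<^sup>2 - m"
      by (rule dvd_trans[rotated]) simp
    moreover have "int p dvd a * x\<^sup>2 + b * y\<^sup>2 + c * z\<^sup>2"
      using assms by (intro dvd_add) auto
    ultimately show False
      using assms p_dvd_iff_of_diff by blast
  qed
  then show ?thesis
    by (simp add: dens_def del: power_Suc)
qed

text \<open>
  By Hensel's lemma the points with \<open>x\<close> a unit contribute the same amount at every level \<open>k \<ge> 1\<close>;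
  the points with \<open>x \<in> p\<int>\<close> are counted by the form in which \<open>a\<close> is replaced by \<open>p\<^sup>2 a\<close>.
\<close>
lemma dens_split:
  assumes "\<not> int p dvd a"
  shows "dens (Suc k) m a b c
    = (\<Sum>y\<in>{0..<int p}. \<Sum>z\<in>{0..<int p}. unit_roots a (m - b * y\<^sup>2 - c * z\<^sup>2)) / real p ^ 2
      + dens (Suc k) m (int p ^ 2 * a) b c / real p"
proof -
  let ?I = "{0..<int p ^ Suc k}"
  \<comment> \<open>The sum over \<open>x\<close> is moved innermost, where it becomes a root count
    for fixed \<open>y\<close> and \<open>z\<close>.\<close>
  have D: "dens (Suc k) m u b c
      = (\<Sum>y\<in>?I. \<Sum>z\<in>?I. root_count (Suc k) u (m - b * y\<^sup>2 - c * z\<^sup>2)) / real p ^ (2 * Suc k)" for u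
  proof -
    have "u * x\<^sup>2 - (m - b * y\<^sup>2 - c * z\<^sup>2) = u * x\<^sup>2 + b * y\<^sup>2 + c * z\<^sup>2 - m" for x y z
      by simp
    then have "(\<Sum>y\<in>?I. \<Sum>z\<in>?I. root_count (Suc k) u (m - b * y\<^sup>2 - c * z\<^sup>2))
       = (\<Sum>y\<in>?I. \<Sum>z\<in>?I. \<Sum>x\<in>?I. of_bool (int p ^ Suc k dvd u * x\<^sup>2 + b * y\<^sup>2 + c * z\<^sup>2 - m))"
      by (simp only: root_count_def)
    also have "\<dots> = (\<Sum>y\<in>?I. \<Sum>x\<in>?I. \<Sum>z\<in>?I. of_bool (int p ^ Suc k dvd u * x\<^sup>2 + b * y\<^sup>2 + c * z\<^sup>2 - m))"
      by (rule sum.cong[OF refl], rule sum.swap)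
    also have "\<dots> = (\<Sum>x\<in>?I. \<Sum>y\<in>?I. \<Sum>z\<in>?I. of_bool (int p ^ Suc k dvd u * x\<^sup>2 + b * y\<^sup>2 + c * z\<^sup>2 - m))"
      by (rule sum.swap)
    finally show ?thesis
      by (simp only: dens_def)
  qed
  \<comment> \<open>The unit part depends on \<open>y\<close> and \<open>z\<close> only modulo
    \<open>p\<close>. The factor \<open>p ^ (2 * k)\<close> gained here cancels against the
    normalisation up to \<open>1 / p^2\<close>.\<close>
  have "(\<Sum>y\<in>{0..<int p * int (p ^ k)}. \<Sum>z\<in>{0..<int p * int (p ^ k)}. unit_roots a (m - b * y\<^sup>2 - c * z\<^sup>2))
      = real (p ^ k) ^ 2 * (\<Sum>y\<in>{0..<int p}. \<Sum>z\<in>{0..<int p}. unit_roots a (m - b * y\<^sup>2 - c * z\<^sup>2))"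
  proof (rule sum_periodic_mult2)
    fix x y x' y' assume "int p dvd x - x'" "int p dvd y - y'"
    then have "int p dvd - (b * x\<^sup>2 - b * x'\<^sup>2) + - (c * y\<^sup>2 - c * y'\<^sup>2)"
      by (intro dvd_add dvd_square_diff iffD2[OF dvd_minus_iff])
    then show "unit_roots a (m - b * x\<^sup>2 - c * y\<^sup>2) = unit_roots a (m - b * x'\<^sup>2 - c * y'\<^sup>2)"
      by (intro unit_roots_cong) (simp add: algebra_simps)
  qed simp
  then have S: "(\<Sum>y\<in>?I. \<Sum>z\<in>?I. unit_roots a (m - b * y\<^sup>2 - c * z\<^sup>2))
      = real p ^ (2 * k) * (\<Sum>y\<in>{0..<int p}. \<Sum>z\<in>{0..<int p}. unit_roots a (m - b * y\<^sup>2 - c * z\<^sup>2))"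
    by (simp add: power_mult[symmetric] mult.commute)
  show ?thesis
    unfolding D root_count_split[OF assms] sum.distrib sum_divide_distrib[symmetric] S
    using p_pos by (simp add: add_divide_distrib power2_eq_square)
qed

subsection \<open>Character sums and descent\<close>

lemma sum_of_bool_p_dvd: "(\<Sum>x\<in>{0..<int p}. of_bool (int p dvd x)) = (1 :: real)"
proof -
  have "(\<Sum>x\<in>{0..<int p}. of_bool (int p dvd x)) = (\<Sum>x\<in>{0}. of_bool (int p dvd x) :: real)"
    using p_gt_2 by (intro sum.mono_neutral_right) (auto dest: zdvd_imp_le)
  then show ?thesis by simp
qed

text \<open>This is the splitting at level 1. Modulo \<open>p\<close> the coefficient
  \<open>p^2 * a\<close> vanishes, so the second part is 1 if \<open>p\<close> divides
  \<open>n\<close> and 0 otherwise: it accounts for the root \<open>x = 0\<close>.\<close>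

lemma sum_square_roots_mod_p:
  assumes "\<not> int p dvd a"
  shows "(\<Sum>x\<in>{0..<int p}. of_bool (int p dvd a * x\<^sup>2 - n)) = 1 + leg (a * n) p"
proof -
  have "root_count (Suc 0) (int p ^ 2 * a) n = real p * of_bool (int p dvd n)"
    unfolding root_count_def by (simp add: power2_eq_square mult.assoc dvd_diff_right_iff)
  then show ?thesis
    using root_count_split[OF assms, of 0 n] p_pos
    by (auto simp: root_count_def unit_roots_def simp del: sum_of_bool_eq)
qed

text \<open>Double counting of the points of \<open>x^2 - y^2 = n\<close> modulo \<open>p\<close>:
  for fixed \<open>y\<close> there are \<open>1 + leg (y^2 + n) p\<close> values of
  \<open>x\<close>; a linear change of variables gives the total directly.\<close>

lemma sum_leg_square_add:
  "(\<Sum>y\<in>{0..<int p}. leg (y\<^sup>2 + n) p) = real p * of_bool (int p dvd n) - 1"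
proof -
  let ?I = "{0..<int p}"
  have "(\<Sum>x\<in>?I. \<Sum>y\<in>?I. of_bool (int p dvd x\<^sup>2 - y\<^sup>2 - n) :: real)
      = (\<Sum>y\<in>?I. \<Sum>x\<in>?I. of_bool (int p dvd 1 * x\<^sup>2 - (y\<^sup>2 + n)))"
    by (subst sum.swap) (simp add: diff_diff_eq)
  also have "\<dots> = (\<Sum>y\<in>?I. 1 + leg (1 * (y\<^sup>2 + n)) p)"
    using p_gt_2 by (intro sum.cong refl sum_square_roots_mod_p) auto
  also have "\<dots> = real p + (\<Sum>y\<in>?I. leg (y\<^sup>2 + n) p)"
    by (simp add: sum.distrib)
  finally have 1: "(\<Sum>x\<in>?I. \<Sum>y\<in>?I. of_bool (int p dvd x\<^sup>2 - y\<^sup>2 - n))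
      = real p + (\<Sum>y\<in>?I. leg (y\<^sup>2 + n) p)" .
  \<comment> \<open>Putting \<open>y = x - s\<close> makes the equation linear in \<open>x\<close>,
    namely \<open>2 * s * x = s^2 + n\<close>. It has one solution for each \<open>s\<close> prime
    to \<open>p\<close>; for \<open>s = 0\<close> it has \<open>p\<close> solutions or none.\<close>
  have "(\<Sum>x\<in>?I. \<Sum>y\<in>?I. of_bool (int p dvd x\<^sup>2 - y\<^sup>2 - n) :: real)
      = (\<Sum>x\<in>?I. \<Sum>s\<in>?I. of_bool (int p dvd x\<^sup>2 - (x - s)\<^sup>2 - n))"
  proof (rule sum.cong[OF refl], rule sum_periodic_reindex[symmetric])
    fix x y y' :: int assume "int p dvd y - y'"
    then have "int p dvd (x\<^sup>2 - y'\<^sup>2 - n) - (x\<^sup>2 - y\<^sup>2 - n)"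
      using dvd_square_diff[of "int p" y y' 1] by simp
    from p_dvd_iff_of_diff[OF this]
    show "(of_bool (int p dvd x\<^sup>2 - y\<^sup>2 - n) :: real) = of_bool (int p dvd x\<^sup>2 - y'\<^sup>2 - n)"
      by simp
  qed (use p_gt_2 in \<open>auto simp: dvd_diff_commute\<close>)
  also have "\<dots> = (\<Sum>s\<in>?I. \<Sum>x\<in>?I. of_bool (int p dvd 2 * s * x - s\<^sup>2 - n))"
    by (subst sum.swap) (simp add: power2_eq_square algebra_simps)
  also have "\<dots> = (\<Sum>s\<in>?I. 1 + of_bool (s = 0) * (real p * of_bool (int p dvd n) - 1))"
  proof (rule sum.cong[OF refl])
    fix s assume s: "s \<in> ?I"
    show "(\<Sum>x\<in>?I. of_bool (int p dvd 2 * s * x - s\<^sup>2 - n))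
        = 1 + of_bool (s = 0) * (real p * of_bool (int p dvd n) - 1)"
    proof (cases "s = 0")
      case False
      then have "\<not> int p dvd s"
        using s by (auto dest: zdvd_imp_le)
      then have "(\<Sum>x\<in>?I. of_bool (int p dvd 2 * s * x - s\<^sup>2 - n) :: real) = (\<Sum>x\<in>?I. of_bool (int p dvd x))"
        using p_gt_2 by (intro sum_periodic_reindex[of "int p" "\<lambda>x. of_bool (int p dvd x)"])
          (auto dest: p_dvd_iff_of_diff simp flip: right_diff_distrib)
      then show ?thesis
        using False by (simp add: sum_of_bool_p_dvd del: sum_of_bool_eq)
    qed simp
  qed
  also have "\<dots> = real p + (real p * of_bool (int p dvd n) - 1)"
    using p_pos by (simp add: sum.distrib sum_distrib_right[symmetric])
  finally show ?thesis
    using 1 by simp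
qed

text \<open>With \<open>v\<close> inverse to \<open>u\<close>, the factor \<open>leg u p\<close>
  comes out and \<open>y^2 + v * n\<close> remains; \<open>v * n\<close> and \<open>n\<close> are
  divisible by \<open>p\<close> simultaneously.\<close>

lemma sum_leg_quadratic:
  assumes "\<not> int p dvd u"
  shows "(\<Sum>y\<in>{0..<int p}. leg (u * y\<^sup>2 + n) p) = leg u p * (real p * of_bool (int p dvd n) - 1)"
proof -
  obtain v where v: "int p dvd u * v - 1"
    using inverse_mod_p[OF assms] .
  have nv: "\<not> int p dvd v"
    using p_dvd_iff_of_diff[OF v] p_gt_2 by auto
  have "leg (u * y\<^sup>2 + n) p = leg u p * leg (y\<^sup>2 + v * n) p" for y
  proof -
    have "int p dvd n * (u * v - 1)"
      using v by simp
    also have "n * (u * v - 1) = u * (y\<^sup>2 + v * n) - (u * y\<^sup>2 + n)"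
      by (simp add: algebra_simps)
    finally show ?thesis
      using Legendre_cong by (simp add: Legendre_mult[symmetric] of_int_mult[symmetric] del: of_int_mult)
  qed
  then show ?thesis
    using nv by (simp add: sum_distrib_left[symmetric] sum_leg_square_add)
qed

text \<open>If \<open>p\<close> divides \<open>n\<close>, the symbol vanishes and the indicator
  cancels the 1. This form can be summed term by term.\<close>

lemma unit_roots_altdef: "unit_roots a n = 1 + leg (a * n) p - of_bool (int p dvd n)"
  by (simp add: unit_roots_def)

lemma sum_unit_roots:
  assumes "\<not> int p dvd a" "\<not> int p dvd b"
  shows "(\<Sum>y\<in>{0..<int p}. unit_roots a (m - b * y\<^sup>2))
    = real p - 1 + leg (- a * b) p * (real p * of_bool (int p dvd m) - 1) - leg (b * m) p"
proof -
  have "(\<Sum>y\<in>{0..<int p}. of_bool (int p dvd m - b * y\<^sup>2)) = 1 + leg (b * m) p"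
    using sum_square_roots_mod_p[OF assms(2), of m] by (simp only: dvd_diff_commute)
  moreover have "(\<Sum>y\<in>{0..<int p}. leg (a * (m - b * y\<^sup>2)) p)
      = leg (- a * b) p * (real p * of_bool (int p dvd m) - 1)"
    using sum_leg_quadratic[of "- a * b" "a * m"] assms by (simp add: algebra_simps)
  ultimately show ?thesis
    by (simp add: unit_roots_altdef sum.distrib sum_subtractf del: sum_of_bool_eq)
qed

text \<open>For fixed \<open>z\<close>, the sum over \<open>y\<close> is the one-variable sum at
  \<open>m - c * z^2\<close>. Its indicator and symbol terms are then summed over
  \<open>z\<close>.\<close>

lemma sum_unit_roots2:
  assumes "\<not> int p dvd a" "\<not> int p dvd b" "\<not> int p dvd c"
  shows "(\<Sum>y\<in>{0..<int p}. \<Sum>z\<in>{0..<int p}. unit_roots a (m - b * y\<^sup>2 - c * z\<^sup>2))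
    = real p * (real p - 1) + leg (- a * b) p * real p * leg (c * m) p
      - leg (- b * c) p * (real p * of_bool (int p dvd m) - 1)"
proof -
  have 1: "(\<Sum>z\<in>{0..<int p}. of_bool (int p dvd m - c * z\<^sup>2)) = 1 + leg (c * m) p"
    using sum_square_roots_mod_p[OF assms(3), of m] by (simp only: dvd_diff_commute)
  have 2: "(\<Sum>z\<in>{0..<int p}. leg (b * (m - c * z\<^sup>2)) p)
      = leg (- b * c) p * (real p * of_bool (int p dvd m) - 1)"
    using sum_leg_quadratic[of "- b * c" "b * m"] assms by (simp add: algebra_simps)
  have "(\<Sum>y\<in>{0..<int p}. \<Sum>z\<in>{0..<int p}. unit_roots a (m - b * y\<^sup>2 - c * z\<^sup>2))
      = (\<Sum>z\<in>{0..<int p}. \<Sum>y\<in>{0..<int p}. unit_roots a ((m - c * z\<^sup>2) - b * y\<^sup>2))"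
    by (subst sum.swap) (simp add: algebra_simps)
  also have "\<dots> = (\<Sum>z\<in>{0..<int p}. real p - 1
      + leg (- a * b) p * (real p * of_bool (int p dvd m - c * z\<^sup>2) - 1) - leg (b * (m - c * z\<^sup>2)) p)"
    by (simp only: sum_unit_roots[OF assms(1,2)])
  also have "\<dots> = real p * (real p - 1)
      + leg (- a * b) p * (real p * (\<Sum>z\<in>{0..<int p}. of_bool (int p dvd m - c * z\<^sup>2)) - real p)
      - (\<Sum>z\<in>{0..<int p}. leg (b * (m - c * z\<^sup>2)) p)"
    by (simp add: sum.distrib sum_subtractf sum_distrib_left[symmetric] algebra_simps del: sum_of_bool_eq)
  finally show ?thesis
    unfolding 1 2 by (simp add: algebra_simps)
qed

section \<open>Splitting off the variables with unit coefficients\<close>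

lemma dens_split1:
  assumes "\<not> int p dvd a" "int p dvd b" "int p dvd c"
  shows "dens (Suc k) m a b c = unit_roots a m + dens (Suc k) m (int p ^ 2 * a) b c / real p"
proof -
  have "unit_roots a (m - b * y\<^sup>2 - c * z\<^sup>2) = unit_roots a m" for y z
    using assms by (intro unit_roots_cong) auto
  then show ?thesis
    using p_pos by (simp add: dens_split[OF assms(1)] power2_eq_square)
qed

text \<open>\<open>x\<close> is split off first, then \<open>y\<close> in the remaining form, where
  only \<open>b\<close> is a unit. The terms in \<open>leg (b * m) p\<close> from the two splittings
  cancel.\<close>

lemma dens_split2:
  assumes "\<not> int p dvd a" "\<not> int p dvd b" "int p dvd c"
  shows "dens (Suc k) m a b c
    = (if int p dvd m then (1 - 1 / real p) * (1 + leg (- a * b) p) else 1 - leg (- a * b) p / real p)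
      + dens (Suc k) m (int p ^ 2 * a) (int p ^ 2 * b) c / real p ^ 2"
proof -
  have "unit_roots a (m - b * y\<^sup>2 - c * z\<^sup>2) = unit_roots a (m - b * y\<^sup>2)" for y z
    using assms by (intro unit_roots_cong) auto
  then have S: "(\<Sum>y\<in>{0..<int p}. \<Sum>z\<in>{0..<int p}. unit_roots a (m - b * y\<^sup>2 - c * z\<^sup>2))
      = real p * (\<Sum>y\<in>{0..<int p}. unit_roots a (m - b * y\<^sup>2))"
    by (simp add: sum_distrib_left[symmetric])
  have D: "dens (Suc k) m (int p ^ 2 * a) b c
      = unit_roots b m + dens (Suc k) m (int p ^ 2 * a) (int p ^ 2 * b) c / real p"
    using assms dens_split1[of b "int p ^ 2 * a" c k m] by (simp add: dens_swap12[of _ _ "int p ^ 2 * a"])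
  show ?thesis
    unfolding dens_split[OF assms(1)] D S sum_unit_roots[OF assms(1,2)]
    using p_pos by (cases "int p dvd m") (simp_all add: unit_roots_altdef field_simps power2_eq_square)
qed

text \<open>\<open>x\<close> is split off by the general formula, \<open>y\<close> and
  \<open>z\<close> by \<open>dens_split2\<close> after a rotation of the variables. The terms in
  \<open>leg (- b * c) p\<close> cancel.\<close>

lemma dens_split3:
  assumes "\<not> int p dvd a" "\<not> int p dvd b" "\<not> int p dvd c"
  shows "dens (Suc k) m a b c
    = (if int p dvd m then 1 - 1 / real p ^ 2 else 1 + leg (- a * b * c * m) p / real p)
      + dens (Suc k) m (int p ^ 2 * a) (int p ^ 2 * b) (int p ^ 2 * c) / real p ^ 3"
proof -
  have rotate: "dens (Suc k) m (int p ^ 2 * a) u v = dens (Suc k) m u v (int p ^ 2 * a)" for u v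
    by (simp add: dens_swap12[of _ _ "int p ^ 2 * a"] dens_swap23[of _ _ _ "int p ^ 2 * a"])
  have "dens (Suc k) m (int p ^ 2 * a) b c
      = (if int p dvd m then (1 - 1 / real p) * (1 + leg (- b * c) p) else 1 - leg (- b * c) p / real p)
      + dens (Suc k) m (int p ^ 2 * a) (int p ^ 2 * b) (int p ^ 2 * c) / real p ^ 2"
    unfolding rotate using assms by (intro dens_split2) auto
  moreover have "leg (- a * b * c * m) p = leg (- a * b) p * leg (c * m) p"
    by (simp add: Legendre_mult[symmetric] of_int_mult[symmetric] mult.assoc del: of_int_mult)
  ultimately show ?thesis
    unfolding dens_split[OF assms(1)] sum_unit_roots2[OF assms]
    using p_pos by (simp add: field_simps power2_eq_square power3_eq_cube)
qed

text \<open>In this and the next two lemmas \<open>p\<close> divides the represented number, and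
  after the splitting also every coefficient. \<open>dens_Suc\<close> divides the congruence by
  \<open>p\<close>, so each \<open>p^2\<close> becomes \<open>p\<close>, and its factor
  \<open>p\<close> reduces the denominator.\<close>

lemma dens_descent1:
  assumes "\<not> int p dvd a"
  shows "dens (Suc k) (int p * m) a (int p * b) (int p * c) = dens k m (int p * a) b c"
  using dens_split1[OF assms, of "int p * b" "int p * c" k "int p * m"] dens_Suc[of k m "int p * a" b c] p_pos
  by (simp add: unit_roots_def power2_eq_square mult.assoc)

lemma dens_descent2:
  assumes "\<not> int p dvd a" "\<not> int p dvd b"
  shows "dens (Suc k) (int p * m) a b (int p * c)
    = (1 - 1 / real p) * (1 + leg (- a * b) p) + dens k m (int p * a) (int p * b) c / real p"
  using dens_split2[OF assms, of "int p * c" k "int p * m"] dens_Suc[of k m "int p * a" "int p * b" c] p_pos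
  by (simp add: power2_eq_square mult.assoc)

lemma dens_descent3:
  assumes "\<not> int p dvd a" "\<not> int p dvd b" "\<not> int p dvd c"
  shows "dens (Suc k) (int p * m) a b c
    = 1 - 1 / real p ^ 2 + dens k m (int p * a) (int p * b) (int p * c) / real p ^ 2"
  using dens_split3[OF assms, of k "int p * m"] dens_Suc[of k m "int p * a" "int p * b" "int p * c"] p_pos
  by (simp add: power2_eq_square power3_eq_cube mult.assoc)

section \<open>Transformation rules for the limiting densities\<close>

abbreviation LD :: "int \<Rightarrow> int \<Rightarrow> int \<Rightarrow> int \<Rightarrow> real \<Rightarrow> bool" where
  "LD m a b c d \<equiv> has_local_density p m (diag_form a b c) d"

lemma LD_swap12: "LD m a b c d \<longleftrightarrow> LD m b a c d"
  by (simp add: has_local_density_iff_dens dens_swap12[of _ _ a b])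

lemma LD_swap23: "LD m a b c d \<longleftrightarrow> LD m a c b d"
  by (simp add: has_local_density_iff_dens dens_swap23[of _ _ a b c])

text \<open>An affine relation between successive levels passes to the limit. The factor is written
  as a division: \<open>r\<close> is 1, \<open>p\<close> or \<open>p^2\<close> in the descents and
  \<open>1 / p\<close> for scaling.\<close>

lemma LD_SucI:
  assumes "r \<noteq> 0" "\<And>k. dens (Suc k) m' a' b' c' = s + dens k m a b c / r" "LD m a b c d"
  shows "LD m' a' b' c' (s + d / r)"
  using assms(1,3) unfolding has_local_density_iff_dens
  by (subst filterlim_sequentially_Suc[symmetric], unfold assms(2)) (intro tendsto_intros)

lemma LD_constI:
  assumes "\<And>k. dens (Suc k) m a b c = d"
  shows "LD m a b c d"
  unfolding has_local_density_iff_dens by (subst filterlim_sequentially_Suc[symmetric]) (simp add: assms)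

lemma LD_scale: "LD m a b c d \<Longrightarrow> LD (int p * m) (int p * a) (int p * b) (int p * c) (real p * d)"
  using LD_SucI[of "1 / real p" "int p * m" "int p * a" "int p * b" "int p * c" 0 m a b c d] p_pos
  by (simp add: dens_Suc mult.commute[of d])

lemma LD_zero:
  assumes "int p dvd a" "int p dvd b" "int p dvd c" "\<not> int p dvd m"
  shows "LD m a b c 0"
  using assms by (intro LD_constI dens_eq_0)

text \<open>For a unit \<open>m\<close>, the form left after splitting off all unit variables has
  only coefficients divisible by \<open>p\<close> and does not represent \<open>m\<close>. So the
  densities are constant from level 1 on, here and in the next two lemmas.\<close>

lemma LD_unit1:
  assumes "\<not> int p dvd a" "int p dvd b" "int p dvd c" "\<not> int p dvd m"
  shows "LD m a b c (1 + leg (a * m) p)"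
  using assms by (intro LD_constI) (simp add: dens_split1 dens_eq_0 unit_roots_def)

lemma LD_unit2:
  assumes "\<not> int p dvd a" "\<not> int p dvd b" "int p dvd c" "\<not> int p dvd m"
  shows "LD m a b c (1 - leg (- a * b) p / real p)"
  using assms by (intro LD_constI) (simp add: dens_split2 dens_eq_0)

lemma LD_unit3:
  assumes "\<not> int p dvd a" "\<not> int p dvd b" "\<not> int p dvd c" "\<not> int p dvd m"
  shows "LD m a b c (1 + leg (- a * b * c * m) p / real p)"
  using assms by (intro LD_constI) (simp add: dens_split3 dens_eq_0)

lemma LD_descent1:
  assumes "\<not> int p dvd a" "LD m (int p * a) b c d"
  shows "LD (int p * m) a (int p * b) (int p * c) d"
  using LD_SucI[of 1 "int p * m" a "int p * b" "int p * c" 0 m "int p * a" b c d] assms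
  by (simp add: dens_descent1)

lemma LD_descent2:
  assumes "\<not> int p dvd a" "\<not> int p dvd b" "LD m (int p * a) (int p * b) c d"
  shows "LD (int p * m) a b (int p * c) ((1 - 1 / real p) * (1 + leg (- a * b) p) + d / real p)"
  using p_pos by (intro LD_SucI[OF _ dens_descent2[OF assms(1,2)] assms(3)]) simp

lemma LD_descent3:
  assumes "\<not> int p dvd a" "\<not> int p dvd b" "\<not> int p dvd c"
    and "LD m (int p * a) (int p * b) (int p * c) d"
  shows "LD (int p * m) a b c (1 - 1 / real p ^ 2 + d / real p ^ 2)"
  using p_pos by (intro LD_SucI[OF _ dens_descent3[OF assms(1-3)] assms(4)]) simp

subsection \<open>Iterated descent\<close>

text \<open>After one descent all coefficients carry a factor \<open>p\<close>, and
  \<open>dens_Suc\<close> restores the form. The constant is factored as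
  \<open>F * (1 - 1 / p)\<close> to show the fixed point \<open>F\<close> of the recursion.\<close>

lemma dens_descent_00:
  assumes "\<not> int p dvd a" "\<not> int p dvd b" "\<not> int p dvd c"
  shows "dens (Suc (Suc k)) (int p ^ 2 * m) a b c = (1 + 1 / real p) * (1 - 1 / real p) + dens k m a b c / real p"
proof -
  have "dens (Suc (Suc k)) (int p ^ 2 * m) a b c = 1 - 1 / real p ^ 2 + real p * dens k m a b c / real p ^ 2"
    using dens_descent3[OF assms, of "Suc k" "int p * m"] unfolding dens_Suc
    by (simp only: power2_eq_square mult.assoc)
  also have "\<dots> = (1 + 1 / real p) * (1 - 1 / real p) + dens k m a b c / real p"
    using p_pos by (simp add: power2_eq_square algebra_simps)
  finally show ?thesis .
qed

text \<open>The first descent moves the factor \<open>p\<close> from \<open>c\<close> to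
  \<open>a\<close> and \<open>b\<close>. Then \<open>c\<close> is the only unit coefficient, and the
  second descent moves it back.\<close>

lemma dens_descent_01:
  assumes "\<not> int p dvd a" "\<not> int p dvd b" "\<not> int p dvd c"
  shows "dens (Suc (Suc k)) (int p ^ 2 * m) a b (int p * c)
    = (1 + leg (- a * b) p) * (1 - 1 / real p) + dens k m a b (int p * c) / real p"
proof -
  have "dens (Suc k) (int p * m) (int p * a) (int p * b) c = dens (Suc k) (int p * m) c (int p * a) (int p * b)"
    by (simp add: dens_swap12[of _ _ c] dens_swap23[of _ _ _ c])
  also have "\<dots> = dens k m (int p * c) a b"
    using assms by (intro dens_descent1)
  also have "\<dots> = dens k m a b (int p * c)"
    by (simp add: dens_swap12[of _ _ "int p * c"] dens_swap23[of _ _ _ "int p * c"])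
  finally show ?thesis
    using dens_descent2[OF assms(1,2), of "Suc k" "int p * m" c] by (simp add: power2_eq_square mult_ac)
qed

text \<open>As before with the two kinds of descent in the opposite order: first \<open>a\<close> is
  the only unit coefficient, then \<open>b\<close> and \<open>c\<close> are the units.\<close>

lemma dens_descent_11:
  assumes "\<not> int p dvd a" "\<not> int p dvd b" "\<not> int p dvd c"
  shows "dens (Suc (Suc k)) (int p ^ 2 * m) a (int p * b) (int p * c)
    = (1 + leg (- b * c) p) * (1 - 1 / real p) + dens k m a (int p * b) (int p * c) / real p"
proof -
  have "dens (Suc (Suc k)) (int p ^ 2 * m) a (int p * b) (int p * c) = dens (Suc k) (int p * m) (int p * a) b c"
    using dens_descent1[OF assms(1), of "Suc k" "int p * m" b c] by (simp add: power2_eq_square mult_ac)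
  also have "\<dots> = dens (Suc k) (int p * m) b c (int p * a)"
    by (simp add: dens_swap12[of _ _ "int p * a"] dens_swap23[of _ _ _ "int p * a"])
  also have "\<dots> = (1 - 1 / real p) * (1 + leg (- b * c) p) + dens k m (int p * b) (int p * c) a / real p"
    using assms by (intro dens_descent2)
  also have "dens k m (int p * b) (int p * c) a = dens k m a (int p * b) (int p * c)"
    by (simp add: dens_swap12[of _ _ a] dens_swap23[of _ _ _ a])
  finally show ?thesis by (simp add: mult.commute)
qed

text \<open>
  For coefficients that reproduce themselves under the descent \<open>p\<^sup>2 m \<mapsto> m\<close>, the density is pulled
  towards the fixed point \<open>F\<close> by a factor \<open>1 / p\<close> in each step.
\<close>
lemma LD_contract:
  assumes rec: "\<And>k m. dens (Suc (Suc k)) (int p ^ 2 * m) a b c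
      = F * (1 - 1 / real p) + dens k m a b c / real p"
    and "LD m a b c d"
  shows "LD (int p ^ (2 * n) * m) a b c (F + (d - F) / real p ^ n)"
proof (induction n)
  case 0
  then show ?case using assms(2) by simp
next
  case (Suc n)
  let ?m = "int p ^ (2 * n) * m" and ?d = "F + (d - F) / real p ^ n"
  have "(\<lambda>k. dens (Suc (Suc k)) (int p ^ 2 * ?m) a b c) \<longlonglongrightarrow> F * (1 - 1 / real p) + ?d / real p"
    unfolding rec using Suc p_pos unfolding has_local_density_iff_dens by (intro tendsto_intros) auto
  moreover have "F * (1 - 1 / real p) + ?d / real p = F + (d - F) / real p ^ Suc n"
    using p_pos by (simp add: field_simps)
  moreover have "int p ^ 2 * ?m = int p ^ (2 * Suc n) * m"
    by (simp add: power2_eq_square)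
  ultimately show ?case
    unfolding has_local_density_iff_dens
    by (subst filterlim_sequentially_Suc[symmetric], subst filterlim_sequentially_Suc[symmetric]) simp
qed

text \<open>Since 0 is fixed under multiplication by \<open>p^2\<close>, the recursion relates
  levels of the same sequence. The distance to \<open>F\<close> decays geometrically along each
  parity, which also proves that the limit exists.\<close>

lemma LD_contract_zero:
  assumes rec: "\<And>k m. dens (Suc (Suc k)) (int p ^ 2 * m) a b c
      = F * (1 - 1 / real p) + dens k m a b c / real p"
  shows "LD 0 a b c F"
proof -
  have step: "dens (2 * n + i) 0 a b c = F + (dens i 0 a b c - F) * (1 / real p) ^ n" for n i
  proof (induction n)
    case (Suc n)
    have "dens (2 * Suc n + i) 0 a b c = dens (Suc (Suc (2 * n + i))) (int p ^ 2 * 0) a b c"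
      by simp
    also have "\<dots> = F + (dens i 0 a b c - F) * (1 / real p) ^ Suc n"
      unfolding rec Suc using p_pos by (simp add: field_simps)
    finally show ?case .
  qed simp
  have lim: "(\<lambda>n. dens (2 * n + i) 0 a b c) \<longlonglongrightarrow> F" for i
  proof -
    have "(\<lambda>n. (1 / real p) ^ n) \<longlonglongrightarrow> 0"
      using p_gt_2 by (intro LIMSEQ_realpow_zero) auto
    then have "(\<lambda>n. F + (dens i 0 a b c - F) * (1 / real p) ^ n) \<longlonglongrightarrow> F + (dens i 0 a b c - F) * 0"
      by (intro tendsto_add tendsto_mult tendsto_const)
    then show ?thesis by (simp add: step)
  qed
  show ?thesis
    unfolding has_local_density_iff_dens using LIMSEQ_even_odd[of "\<lambda>k. dens k 0 a b c" F] lim[of 0] lim[of 1] by simp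
qed

text \<open>Each step multiplies everything by \<open>p\<close> and then trades the coefficient
  \<open>p * a\<close> for \<open>a\<close> by a descent that keeps the density. The scaling leaves
  one factor \<open>p\<close> per step.\<close>

lemma LD_iterate2:
  assumes "\<not> int p dvd a" "LD m a b c d"
  shows "LD (int p ^ (2 * n) * m) a (int p ^ (2 * n) * b) (int p ^ (2 * n) * c) (real p ^ n * d)"
proof (induction n)
  case (Suc n)
  then have "LD (int p * (int p * (int p ^ (2 * n) * m))) a (int p * (int p * (int p ^ (2 * n) * b)))
      (int p * (int p * (int p ^ (2 * n) * c))) (real p * (real p ^ n * d))"
    using assms(1) by (intro LD_descent1[OF _ LD_scale])
  then show ?case by (simp add: mult.assoc)
qed (use assms in simp)

text \<open>Here the factor \<open>p\<close> from scaling cancels against the \<open>1 / p\<close>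
  of the descent with two units, so each step only adds a constant.\<close>

lemma LD_iterate_0:
  assumes "\<not> int p dvd a" "\<not> int p dvd b" "LD m a b c d"
  shows "LD (int p ^ (2 * n) * m) a b (int p ^ (2 * n) * c)
    (real n * ((1 - 1 / real p) * (1 + leg (- a * b) p)) + d)"
proof (induction n)
  case (Suc n)
  let ?d = "real n * ((1 - 1 / real p) * (1 + leg (- a * b) p)) + d"
  have "LD (int p * (int p * (int p ^ (2 * n) * m))) a b (int p * (int p * (int p ^ (2 * n) * c)))
      ((1 - 1 / real p) * (1 + leg (- a * b) p) + real p * ?d / real p)"
    using assms(1,2) Suc by (intro LD_descent2[OF _ _ LD_scale])
  moreover have "(1 - 1 / real p) * (1 + leg (- a * b) p) + real p * ?d / real p
      = real (Suc n) * ((1 - 1 / real p) * (1 + leg (- a * b) p)) + d"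
    using p_pos by (simp add: distrib_right)
  ultimately show ?case by (simp only: mult_Suc_right power_add power2_eq_square mult.assoc)
qed (use assms in simp)

text \<open>Two descents with one unit coefficient, first \<open>b\<close> and then
  \<open>a\<close>, exchange the factor \<open>p\<close> between \<open>a\<close> and
  \<open>b\<close> and restore it. Neither changes the density.\<close>

lemma LD_iterate_1:
  assumes "\<not> int p dvd a" "\<not> int p dvd b" "LD m a (int p * b) c d"
  shows "LD (int p ^ (2 * n) * m) a (int p * b) (int p ^ (2 * n) * c) d"
proof (induction n)
  case (Suc n)
  then have "LD (int p ^ (2 * n) * m) (int p * b) a (int p ^ (2 * n) * c) d"
    by (simp add: LD_swap12)
  then have "LD (int p * (int p ^ (2 * n) * m)) b (int p * a) (int p * (int p ^ (2 * n) * c)) d"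
    using assms(2) by (intro LD_descent1)
  then have "LD (int p * (int p * (int p ^ (2 * n) * m))) a (int p * b)
      (int p * (int p * (int p ^ (2 * n) * c))) d"
    using assms(1) by (intro LD_descent1) (simp_all add: LD_swap12)
  then show ?case by (simp add: mult.assoc)
qed (use assms in simp)

subsection \<open>Evaluation of the densities\<close>

lemma LD_cong:
  "LD m a b c d \<Longrightarrow> m = m' \<Longrightarrow> b = b' \<Longrightarrow> c = c' \<Longrightarrow> d = d' \<Longrightarrow> LD m' a b' c' d'"
  by simp

text \<open>The half exponents in the closed formulas are integers once the parities are fixed; this
  lemma and the next turn them into powers.\<close>

lemma powr_eq_power: "x = real n \<Longrightarrow> real p powr x = real p ^ n"
  using p_pos by (simp add: powr_realpow)

lemma powr_eq_inverse_power: "x = - real n \<Longrightarrow> real p powr x = 1 / real p ^ n"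
  using p_pos by (simp add: powr_minus_divide powr_realpow)

lemma leg_mult: "leg (x * y) p = leg x p * leg y p"
  by (simp add: Legendre_mult)

lemma leg_power_even: "\<not> int p dvd x \<Longrightarrow> leg x p ^ (2 * n) = 1"
  by (simp add: power_mult power2_eq_square)

lemma leg_power_odd: "\<not> int p dvd x \<Longrightarrow> leg x p ^ Suc (2 * n) = leg x p"
  using leg_power_even[of x n] by simp

lemmas LD_contract_00 = LD_contract[OF dens_descent_00]
lemmas LD_contract_01 = LD_contract[OF dens_descent_01]
lemmas LD_contract_11 = LD_contract[OF dens_descent_11]

section \<open>Densities at \<open>p\<close> times a unit\<close>

text \<open>The two digits in these names count the factors \<open>p\<close> displayed in the last
  two coefficients. One descent makes the represented number a unit.\<close>

lemma LD_prime_mult_00: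
  assumes "\<not> int p dvd a" "\<not> int p dvd b" "\<not> int p dvd c" "\<not> int p dvd m"
  shows "LD (int p * m) a b c (1 - 1 / real p ^ 2)"
  using LD_descent3[OF assms(1-3) LD_zero, of m] assms(4) by simp

lemma LD_prime_mult_01:
  assumes "\<not> int p dvd a" "\<not> int p dvd b" "\<not> int p dvd c" "\<not> int p dvd m"
  shows "LD (int p * m) a b (int p * c)
    ((1 - 1 / real p) * (1 + leg (- a * b) p) + (1 + leg (c * m) p) / real p)"
proof (rule LD_descent2[OF assms(1,2)])
  have "LD m c (int p * a) (int p * b) (1 + leg (c * m) p)"
    using assms by (intro LD_unit1) auto
  then show "LD m (int p * a) (int p * b) c (1 + leg (c * m) p)"
    by (simp add: LD_swap12[of _ c] LD_swap23[of _ _ c])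
qed

lemma LD_prime_mult_02:
  assumes "\<not> int p dvd a" "\<not> int p dvd b" "\<not> int p dvd m"
  shows "LD (int p * m) a b (int p * (int p * c)) ((1 - 1 / real p) * (1 + leg (- a * b) p))"
  using LD_descent2[OF assms(1,2) LD_zero, of "int p * c" m] assms(3) by simp

lemma LD_prime_mult_11:
  assumes "\<not> int p dvd a" "\<not> int p dvd b" "\<not> int p dvd c" "\<not> int p dvd m"
  shows "LD (int p * m) a (int p * b) (int p * c) (1 - leg (- b * c) p / real p)"
proof (rule LD_descent1[OF assms(1)])
  have "LD m b c (int p * a) (1 - leg (- b * c) p / real p)"
    using assms by (intro LD_unit2) auto
  then show "LD m (int p * a) b c (1 - leg (- b * c) p / real p)"
    by (simp add: LD_swap12[of _ "int p * a"] LD_swap23[of _ _ "int p * a"])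
qed

lemma LD_prime_mult_12:
  assumes "\<not> int p dvd a" "\<not> int p dvd b" "\<not> int p dvd m"
  shows "LD (int p * m) a (int p * b) (int p * (int p * c)) (1 + leg (b * m) p)"
proof (rule LD_descent1[OF assms(1)])
  have "LD m b (int p * a) (int p * c) (1 + leg (b * m) p)"
    using assms by (intro LD_unit1) auto
  then show "LD m (int p * a) b (int p * c) (1 + leg (b * m) p)"
    by (simp only: LD_swap12[of m b])
qed

lemma LD_prime_mult_22:
  assumes "\<not> int p dvd a" "\<not> int p dvd m"
  shows "LD (int p * m) a (int p * (int p * b)) (int p * (int p * c)) 0"
  using assms by (intro LD_descent1[OF _ LD_zero]) auto

section \<open>Closed formulas by range and parity of the valuations\<close>

context
  fixes a b0 c0 :: int and b1 c1 :: nat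
  assumes a: "\<not> int p dvd a" and b0: "\<not> int p dvd b0" and c0: "\<not> int p dvd c0"
    and b1_le_c1: "b1 \<le> c1"
begin

text \<open>Removing squares of \<open>p\<close> from \<open>m\<close>, \<open>b\<close> and
  \<open>c\<close> leaves a unit \<open>m\<close>, or \<open>p\<close> times a unit with
  \<open>b\<close> and \<open>c\<close> still divisible by \<open>p^2\<close>, where the density is
  0.\<close>

lemma LD_below_b1:
  assumes m0: "\<not> int p dvd m0" and "m1 < b1"
  shows "LD (m0 * int p ^ m1) a (b0 * int p ^ b1) (c0 * int p ^ c1)
    (if even m1 then real p powr (real m1 / 2) * (1 + leg (a * m0) p) else 0)"
proof (cases "even m1")
  case True
  then obtain n where m1: "m1 = 2 * n" ..
  obtain r s where b1: "b1 = Suc (2 * n + r)" and c1: "c1 = Suc (2 * n + s)"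
    using \<open>m1 < b1\<close> b1_le_c1 m1 by (metis less_imp_Suc_add order_less_le_trans)
  have P: "real p powr (real m1 / 2) = real p ^ n"
    by (rule powr_eq_power) (simp add: m1)
  have "LD (int p ^ (2 * n) * m0) a (int p ^ (2 * n) * (int p * (b0 * int p ^ r)))
      (int p ^ (2 * n) * (int p * (c0 * int p ^ s))) (real p ^ n * (1 + leg (a * m0) p))"
    using a m0 by (intro LD_iterate2 LD_unit1) auto
  then show ?thesis
    unfolding P by (rule LD_cong) (use True in \<open>simp_all add: m1 b1 c1 power_add mult_ac\<close>)
next
  case False
  then obtain n where m1: "m1 = Suc (2 * n)"
    by (auto elim: oddE)
  obtain r s where b1: "b1 = Suc (Suc (2 * n + r))" and c1: "c1 = Suc (Suc (2 * n + s))"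
    using \<open>m1 < b1\<close> b1_le_c1 m1 by (metis less_imp_Suc_add order_less_le_trans add_Suc)
  have "LD (int p ^ (2 * n) * (int p * m0)) a (int p ^ (2 * n) * (int p * (int p * (b0 * int p ^ r))))
      (int p ^ (2 * n) * (int p * (int p * (c0 * int p ^ s)))) (real p ^ n * 0)"
    using a m0 by (intro LD_iterate2 LD_prime_mult_22)
  then show ?thesis
    by (rule LD_cong) (use False in \<open>simp_all add: m1 b1 c1 power_add mult_ac\<close>)
qed

text \<open>Squares of \<open>p\<close> are removed first from both \<open>b\<close> and
  \<open>c\<close>, then from \<open>c\<close> alone. The excess \<open>t = m1 - b1\<close> is used
  up before \<open>c\<close> becomes a unit; its parity decides whether a unit or \<open>p\<close>
  times a unit remains.\<close>

lemma LD_between_b1_c1: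
  assumes m0: "\<not> int p dvd m0" and "b1 \<le> m1" "m1 < c1"
  shows "LD (m0 * int p ^ m1) a (b0 * int p ^ b1) (c0 * int p ^ c1)
    (if even b1
     then real p powr (real b1 / 2) *
          (1 - 1 / real p * leg (- a * b0) p ^ (m1 + 1)
           + (1 - 1 / real p) *
             ((real m1 - real b1) / 2 + ((-1) ^ m1 - 1) / 4
              + leg (- a * b0) p * ((real m1 - real b1) / 2 + (1 - (-1) ^ m1) / 4)))
     else real p powr ((real b1 - 1) / 2) *
          (1 + leg a p ^ (m1 + 1) * leg b0 p ^ m1 * leg m0 p))"
proof (cases "even b1")
  case True
  then obtain n where b1: "b1 = 2 * n" ..
  have P: "real p powr (real b1 / 2) = real p ^ n"
    by (rule powr_eq_power) (simp add: b1)
  have ab: "\<not> int p dvd - a * b0"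
    using a b0 by simp
  obtain t where t: "m1 = b1 + t"
    using \<open>b1 \<le> m1\<close> by (auto simp: le_iff_add)
  obtain r where r: "c1 = Suc (m1 + r)"
    using \<open>m1 < c1\<close> by (auto dest: less_imp_Suc_add)
  show ?thesis
  proof (cases "even t")
    case even: True
    then obtain k where k: "t = 2 * k" ..
    have m1: "m1 = 2 * (n + k)"
      by (simp add: t b1 k)
    have L: "leg (- a * b0) p ^ (m1 + 1) = leg (- a * b0) p"
      using leg_power_odd[OF ab, of "n + k"] by (simp only: m1 Suc_eq_plus1)
    have "LD (int p ^ (2 * n) * (int p ^ (2 * k) * m0)) a (int p ^ (2 * n) * b0)
        (int p ^ (2 * n) * (int p ^ (2 * k) * (int p * (c0 * int p ^ r))))
        (real p ^ n * (real k * ((1 - 1 / real p) * (1 + leg (- a * b0) p)) + (1 - leg (- a * b0) p / real p)))"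
      using a b0 m0 by (intro LD_iterate2 LD_iterate_0 LD_unit2) auto
    then show ?thesis
      unfolding P L
      by (rule LD_cong) (use True p_pos in \<open>simp_all add: m1 b1 r power_add mult_ac field_simps\<close>)
  next
    case False
    then obtain k where k: "t = Suc (2 * k)"
      by (auto elim: oddE)
    have m1: "m1 = Suc (2 * (n + k))"
      by (simp add: t b1 k)
    have L: "leg (- a * b0) p ^ (m1 + 1) = 1"
      using leg_power_even[OF ab, of "Suc (n + k)"] by (simp only: m1 Suc_eq_plus1) simp
    have "LD (int p ^ (2 * n) * (int p ^ (2 * k) * (int p * m0))) a (int p ^ (2 * n) * b0)
        (int p ^ (2 * n) * (int p ^ (2 * k) * (int p * (int p * (c0 * int p ^ r)))))
        (real p ^ n * (real k * ((1 - 1 / real p) * (1 + leg (- a * b0) p))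
          + (1 - 1 / real p) * (1 + leg (- a * b0) p)))"
      using a b0 m0 by (intro LD_iterate2 LD_iterate_0 LD_prime_mult_02)
    then show ?thesis
      unfolding P L
      by (rule LD_cong) (use True p_pos in \<open>simp_all add: m1 b1 r power_add mult_ac field_simps\<close>)
  qed
next
  case False
  then obtain n where b1: "b1 = Suc (2 * n)"
    by (auto elim: oddE)
  have P: "real p powr ((real b1 - 1) / 2) = real p ^ n"
    by (rule powr_eq_power) (simp add: b1)
  obtain t where t: "m1 = b1 + t"
    using \<open>b1 \<le> m1\<close> by (auto simp: le_iff_add)
  obtain r where r: "c1 = Suc (m1 + r)"
    using \<open>m1 < c1\<close> by (auto dest: less_imp_Suc_add)
  show ?thesis
  proof (cases "even t")
    case even: True
    then obtain k where k: "t = 2 * k" ..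
    have m1: "m1 = Suc (2 * (n + k))"
      by (simp add: t b1 k)
    have L: "leg a p ^ (m1 + 1) = 1" "leg b0 p ^ m1 = leg b0 p"
      using leg_power_even[OF a, of "Suc (n + k)"] leg_power_odd[OF b0, of "n + k"] by (simp_all add: m1)
    have "LD (int p ^ (2 * n) * (int p ^ (2 * k) * (int p * m0))) a (int p ^ (2 * n) * (int p * b0))
        (int p ^ (2 * n) * (int p ^ (2 * k) * (int p * (int p * (c0 * int p ^ r)))))
        (real p ^ n * (1 + leg (b0 * m0) p))"
      using a b0 m0 by (intro LD_iterate2 LD_iterate_1 LD_prime_mult_12)
    then show ?thesis
      unfolding P L
      by (rule LD_cong) (use False in \<open>simp_all add: m1 b1 r power_add leg_mult mult_ac\<close>)
  next
    case odd: False
    then obtain k where k: "t = Suc (2 * k)"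
      by (auto elim: oddE)
    have m1: "m1 = 2 * Suc (n + k)"
      by (simp add: t b1 k)
    have L: "leg a p ^ (m1 + 1) = leg a p" "leg b0 p ^ m1 = 1"
      using leg_power_odd[OF a, of "Suc (n + k)"] leg_power_even[OF b0, of "Suc (n + k)"]
      by (simp_all only: m1 Suc_eq_plus1)
    have "LD (int p ^ (2 * n) * (int p ^ (2 * Suc k) * m0)) a (int p ^ (2 * n) * (int p * b0))
        (int p ^ (2 * n) * (int p ^ (2 * Suc k) * (int p * (c0 * int p ^ r))))
        (real p ^ n * (1 + leg (a * m0) p))"
      using a b0 m0 by (intro LD_iterate2 LD_iterate_1 LD_unit1) auto
    then show ?thesis
      unfolding P L
      by (rule LD_cong) (use False in \<open>simp_all add: m1 b1 r power_add leg_mult mult_ac\<close>)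
  qed
qed

lemma LD_above_c1_even:
  assumes m0: "\<not> int p dvd m0" and "c1 \<le> m1" "even b1"
  shows "LD (m0 * int p ^ m1) a (b0 * int p ^ b1) (c0 * int p ^ c1)
    (if even c1 \<and> even m1
     then real p powr (real b1 / 2) *
          (1 + 1 / real p
           + real p powr (- real m1 / 2 + real c1 / 2 - 1) * (leg (- a * b0 * c0 * m0) p - 1)
           + (1 - 1 / real p) *
             ((real c1 - real b1) / 2 + leg (- a * b0) p * ((real c1 - real b1) / 2)))
     else if even c1 \<and> odd m1
     then real p powr (real b1 / 2) *
          ((1 + 1 / real p) * (1 - real p powr (- (real m1 + 1) / 2 + real c1 / 2))
           + (1 - 1 / real p) *
             ((real c1 - real b1) / 2 + leg (- a * b0) p * ((real c1 - real b1) / 2)))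
     else if odd c1 \<and> even m1
     then real p powr (real b1 / 2) *
          (1 - real p powr (- real m1 / 2 + (real c1 - 1) / 2) * leg (- a * b0) p * (1 + 1 / real p)
           + 1 / real p * leg (- a * b0) p
           + (1 - 1 / real p) *
             ((real c1 - real b1 - 1) / 2
              + leg (- a * b0) p * ((real c1 - real b1 + 1) / 2)))
     else real p powr (real b1 / 2) *
          (1 + real p powr (- (real m1 + 1) / 2 + (real c1 - 1) / 2)
               * (leg (c0 * m0) p - leg (- a * b0) p)
           + 1 / real p * leg (- a * b0) p
           + (1 - 1 / real p) *
             ((real c1 - real b1 - 1) / 2
              + leg (- a * b0) p * ((real c1 - real b1 + 1) / 2))))"
proof -
  obtain n where b1: "b1 = 2 * n"
    using \<open>even b1\<close> ..
  have P: "real p powr (real b1 / 2) = real p ^ n"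
    by (rule powr_eq_power) (simp add: b1)
  obtain t where t: "c1 = b1 + t"
    using b1_le_c1 by (auto simp: le_iff_add)
  obtain u where u: "m1 = c1 + u"
    using \<open>c1 \<le> m1\<close> by (auto simp: le_iff_add)
  \<comment> \<open>The letters give the parities of \<open>c1\<close> and \<open>m1\<close>, not of
    \<open>t\<close> and \<open>u\<close>. \<open>k\<close> counts the steps on \<open>c\<close>
    alone and \<open>l\<close> the contractions, except in case \<open>oe\<close>.\<close>
  consider (ee) k l where "t = 2 * k" "u = 2 * l" | (eo) k l where "t = 2 * k" "u = Suc (2 * l)"
    | (oe) k l where "t = Suc (2 * k)" "u = Suc (2 * l)" | (oo) k l where "t = Suc (2 * k)" "u = 2 * l"
    by (metis evenE oddE Suc_eq_plus1)
  then show ?thesis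
  proof cases
    case ee
    have c1: "c1 = 2 * (n + k)" and m1: "m1 = 2 * (n + k + l)"
      by (simp_all add: t u b1 ee)
    have Q: "real p powr (- real m1 / 2 + real c1 / 2 - 1) = 1 / real p ^ Suc l"
      by (rule powr_eq_inverse_power) (simp add: m1 c1 field_simps)
    have "LD (int p ^ (2 * n) * (int p ^ (2 * k) * (int p ^ (2 * l) * m0))) a (int p ^ (2 * n) * b0)
        (int p ^ (2 * n) * (int p ^ (2 * k) * c0))
        (real p ^ n * (real k * ((1 - 1 / real p) * (1 + leg (- a * b0) p))
          + ((1 + 1 / real p) + ((1 + leg (- a * b0 * c0 * m0) p / real p) - (1 + 1 / real p)) / real p ^ l)))"
      using a b0 c0 m0 by (intro LD_iterate2 LD_iterate_0 LD_contract_00 LD_unit3)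
    then show ?thesis
      unfolding P Q
      by (rule LD_cong) (use p_pos in \<open>simp_all add: m1 b1 c1 power_add mult_ac field_simps\<close>)
  next
    case eo
    have c1: "c1 = 2 * (n + k)" and m1: "m1 = Suc (2 * (n + k + l))"
      by (simp_all add: t u b1 eo)
    have Q: "real p powr (- (real m1 + 1) / 2 + real c1 / 2) = 1 / real p ^ Suc l"
      by (rule powr_eq_inverse_power) (simp add: m1 c1 field_simps)
    have "LD (int p ^ (2 * n) * (int p ^ (2 * k) * (int p ^ (2 * l) * (int p * m0)))) a (int p ^ (2 * n) * b0)
        (int p ^ (2 * n) * (int p ^ (2 * k) * c0))
        (real p ^ n * (real k * ((1 - 1 / real p) * (1 + leg (- a * b0) p))
          + ((1 + 1 / real p) + ((1 - 1 / real p ^ 2) - (1 + 1 / real p)) / real p ^ l)))"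
      using a b0 c0 m0 by (intro LD_iterate2 LD_iterate_0 LD_contract_00 LD_prime_mult_00)
    then show ?thesis
      unfolding P Q
      by (rule LD_cong) (use p_pos in \<open>simp_all add: m1 b1 c1 power_add power2_eq_square mult_ac field_simps\<close>)
  next
    case oe
    have c1: "c1 = Suc (2 * (n + k))" and m1: "m1 = 2 * Suc (n + k + l)"
      by (simp_all add: t u b1 oe)
    have Q: "real p powr (- real m1 / 2 + (real c1 - 1) / 2) = 1 / real p ^ Suc l"
      by (rule powr_eq_inverse_power) (simp add: m1 c1 field_simps)
    \<comment> \<open>Since \<open>c\<close> keeps one factor \<open>p\<close>, \<open>m\<close> has
      \<open>p ^ (2 * Suc l)\<close> left, one contraction more than \<open>l\<close>.\<close>
    have "LD (int p ^ (2 * n) * (int p ^ (2 * k) * (int p ^ (2 * Suc l) * m0))) a (int p ^ (2 * n) * b0)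
        (int p ^ (2 * n) * (int p ^ (2 * k) * (int p * c0)))
        (real p ^ n * (real k * ((1 - 1 / real p) * (1 + leg (- a * b0) p))
          + ((1 + leg (- a * b0) p) + ((1 - leg (- a * b0) p / real p) - (1 + leg (- a * b0) p)) / real p ^ Suc l)))"
      using a b0 c0 m0 by (intro LD_iterate2 LD_iterate_0 LD_contract_01 LD_unit2) auto
    then show ?thesis
      unfolding P Q
      by (rule LD_cong) (use p_pos in \<open>simp_all add: m1 b1 c1 power_add mult_ac field_simps\<close>)
  next
    case oo
    have c1: "c1 = Suc (2 * (n + k))" and m1: "m1 = Suc (2 * (n + k + l))"
      by (simp_all add: t u b1 oo)
    have Q: "real p powr (- (real m1 + 1) / 2 + (real c1 - 1) / 2) = 1 / real p ^ Suc l"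
      by (rule powr_eq_inverse_power) (simp add: m1 c1 field_simps)
    have "LD (int p ^ (2 * n) * (int p ^ (2 * k) * (int p ^ (2 * l) * (int p * m0)))) a (int p ^ (2 * n) * b0)
        (int p ^ (2 * n) * (int p ^ (2 * k) * (int p * c0)))
        (real p ^ n * (real k * ((1 - 1 / real p) * (1 + leg (- a * b0) p))
          + ((1 + leg (- a * b0) p) + (((1 - 1 / real p) * (1 + leg (- a * b0) p) + (1 + leg (c0 * m0) p) / real p)
              - (1 + leg (- a * b0) p)) / real p ^ l)))"
      using a b0 c0 m0 by (intro LD_iterate2 LD_iterate_0 LD_contract_01 LD_prime_mult_01)
    then show ?thesis
      unfolding P Q
      by (rule LD_cong) (use p_pos in \<open>simp_all add: m1 b1 c1 power_add mult_ac field_simps\<close>)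
  qed
qed

lemma LD_above_c1_odd:
  assumes m0: "\<not> int p dvd m0" and "c1 \<le> m1" "odd b1"
  shows "LD (m0 * int p ^ m1) a (b0 * int p ^ b1) (c0 * int p ^ c1)
    (if even c1 \<and> even m1
     then real p powr ((real b1 - 1) / 2) *
          (1 + leg (- a * c0) p
           - real p powr (- real m1 / 2 + real c1 / 2) * (1 + 1 / real p) * leg (- a * c0) p)
     else if even c1 \<and> odd m1
     then real p powr ((real b1 - 1) / 2) *
          (1 + leg (- a * c0) p
           + real p powr (- (real m1 + 1) / 2 + real c1 / 2)
               * (leg (b0 * m0) p - leg (- a * c0) p))
     else if odd c1 \<and> even m1
     then real p powr ((real b1 - 1) / 2) *
          (1 + leg (- b0 * c0) p
           + real p powr (- real m1 / 2 + (real c1 - 1) / 2)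
               * (leg (a * m0) p - leg (- b0 * c0) p))
     else real p powr ((real b1 - 1) / 2) *
          (1 + leg (- b0 * c0) p
           - real p powr ((- real m1 + real c1) / 2) * (1 + 1 / real p) * leg (- b0 * c0) p))"
proof -
  obtain n where b1: "b1 = Suc (2 * n)"
    using \<open>odd b1\<close> by (auto elim: oddE)
  have P: "real p powr ((real b1 - 1) / 2) = real p ^ n"
    by (rule powr_eq_power) (simp add: b1)
  obtain t where t: "c1 = b1 + t"
    using b1_le_c1 by (auto simp: le_iff_add)
  obtain u where u: "m1 = c1 + u"
    using \<open>c1 \<le> m1\<close> by (auto simp: le_iff_add)
  \<comment> \<open>Again the letters are the parities of \<open>c1\<close> and \<open>m1\<close>;
    as \<open>b1\<close> is odd, \<open>c1\<close> is even exactly for odd \<open>t\<close>.\<close>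
  consider (ee) k l where "t = Suc (2 * k)" "u = 2 * l" | (eo) k l where "t = Suc (2 * k)" "u = Suc (2 * l)"
    | (oe) k l where "t = 2 * k" "u = Suc (2 * l)" | (oo) k l where "t = 2 * k" "u = 2 * l"
    by (metis evenE oddE Suc_eq_plus1)
  then show ?thesis
  proof cases
    case ee
    have c1: "c1 = 2 * Suc (n + k)" and m1: "m1 = 2 * Suc (n + k + l)"
      by (simp_all add: t u b1 ee)
    have Q: "real p powr (- real m1 / 2 + real c1 / 2) = 1 / real p ^ l"
      by (rule powr_eq_inverse_power) (simp add: m1 c1 field_simps)
    \<comment> \<open>For even \<open>c1\<close> the reduced form keeps its factor \<open>p\<close>
      at \<open>b0\<close>. Exchanging the last two variables makes it the \<open>01\<close> form
      with \<open>c0\<close> as second unit.\<close>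
    have "LD (int p ^ (2 * l) * m0) a c0 (int p * b0) ((1 + leg (- a * c0) p)
        + ((1 - leg (- a * c0) p / real p) - (1 + leg (- a * c0) p)) / real p ^ l)"
      using a b0 c0 m0 by (intro LD_contract_01 LD_unit2) auto
    then have "LD (int p ^ (2 * n) * (int p ^ (2 * Suc k) * (int p ^ (2 * l) * m0))) a (int p ^ (2 * n) * (int p * b0))
        (int p ^ (2 * n) * (int p ^ (2 * Suc k) * c0))
        (real p ^ n * ((1 + leg (- a * c0) p)
          + ((1 - leg (- a * c0) p / real p) - (1 + leg (- a * c0) p)) / real p ^ l))"
      using a b0 by (intro LD_iterate2 LD_iterate_1) (simp_all add: LD_swap23)
    then show ?thesis
      unfolding P Q
      by (rule LD_cong) (use p_pos in \<open>simp_all add: m1 b1 c1 power_add mult_ac field_simps\<close>)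
  next
    case eo
    have c1: "c1 = 2 * Suc (n + k)" and m1: "m1 = Suc (2 * Suc (n + k + l))"
      by (simp_all add: t u b1 eo)
    have Q: "real p powr (- (real m1 + 1) / 2 + real c1 / 2) = 1 / real p ^ Suc l"
      by (rule powr_eq_inverse_power) (simp add: m1 c1 field_simps)
    have "LD (int p ^ (2 * l) * (int p * m0)) a c0 (int p * b0) ((1 + leg (- a * c0) p)
        + (((1 - 1 / real p) * (1 + leg (- a * c0) p) + (1 + leg (b0 * m0) p) / real p)
            - (1 + leg (- a * c0) p)) / real p ^ l)"
      using a b0 c0 m0 by (intro LD_contract_01 LD_prime_mult_01)
    then have "LD (int p ^ (2 * n) * (int p ^ (2 * Suc k) * (int p ^ (2 * l) * (int p * m0)))) a
        (int p ^ (2 * n) * (int p * b0)) (int p ^ (2 * n) * (int p ^ (2 * Suc k) * c0))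
        (real p ^ n * ((1 + leg (- a * c0) p)
          + (((1 - 1 / real p) * (1 + leg (- a * c0) p) + (1 + leg (b0 * m0) p) / real p)
              - (1 + leg (- a * c0) p)) / real p ^ l))"
      using a b0 by (intro LD_iterate2 LD_iterate_1) (simp_all add: LD_swap23)
    then show ?thesis
      unfolding P Q
      by (rule LD_cong) (use p_pos in \<open>simp_all add: m1 b1 c1 power_add mult_ac field_simps\<close>)
  next
    case oe
    have c1: "c1 = Suc (2 * (n + k))" and m1: "m1 = 2 * Suc (n + k + l)"
      by (simp_all add: t u b1 oe)
    have Q: "real p powr (- real m1 / 2 + (real c1 - 1) / 2) = 1 / real p ^ Suc l"
      by (rule powr_eq_inverse_power) (simp add: m1 c1 field_simps)
    have "LD (int p ^ (2 * n) * (int p ^ (2 * k) * (int p ^ (2 * Suc l) * m0))) a (int p ^ (2 * n) * (int p * b0))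
        (int p ^ (2 * n) * (int p ^ (2 * k) * (int p * c0)))
        (real p ^ n * ((1 + leg (- b0 * c0) p)
          + ((1 + leg (a * m0) p) - (1 + leg (- b0 * c0) p)) / real p ^ Suc l))"
      using a b0 c0 m0 by (intro LD_iterate2 LD_iterate_1 LD_contract_11 LD_unit1) auto
    then show ?thesis
      unfolding P Q
      by (rule LD_cong) (use p_pos in \<open>simp_all add: m1 b1 c1 power_add mult_ac field_simps\<close>)
  next
    case oo
    have c1: "c1 = Suc (2 * (n + k))" and m1: "m1 = Suc (2 * (n + k + l))"
      by (simp_all add: t u b1 oo)
    have Q: "real p powr ((- real m1 + real c1) / 2) = 1 / real p ^ l"
      by (rule powr_eq_inverse_power) (simp add: m1 c1 field_simps)
    have "LD (int p ^ (2 * n) * (int p ^ (2 * k) * (int p ^ (2 * l) * (int p * m0)))) a (int p ^ (2 * n) * (int p * b0))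
        (int p ^ (2 * n) * (int p ^ (2 * k) * (int p * c0)))
        (real p ^ n * ((1 + leg (- b0 * c0) p)
          + ((1 - leg (- b0 * c0) p / real p) - (1 + leg (- b0 * c0) p)) / real p ^ l))"
      using a b0 c0 m0 by (intro LD_iterate2 LD_iterate_1 LD_contract_11 LD_prime_mult_11)
    then show ?thesis
      unfolding P Q
      by (rule LD_cong) (use p_pos in \<open>simp_all add: m1 b1 c1 power_add mult_ac field_simps\<close>)
  qed
qed

text \<open>The coefficient reductions leave 0 unchanged, and the reduced form contributes the fixed
  point itself in place of a contracted value.\<close>

lemma LD_at_zero:
  "LD 0 a (b0 * int p ^ b1) (c0 * int p ^ c1)
    (if even b1 \<and> even c1
     then real p powr (real b1 / 2) *
          (1 + 1 / real p
           + (1 - 1 / real p) *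
             ((real c1 - real b1) / 2 + leg (- a * b0) p * ((real c1 - real b1) / 2)))
     else if even b1 \<and> odd c1
     then real p powr (real b1 / 2) *
          (1 + 1 / real p * leg (- a * b0) p
           + (1 - 1 / real p) *
             ((real c1 - real b1 - 1) / 2
              + leg (- a * b0) p * ((real c1 - real b1 + 1) / 2)))
     else if odd b1 \<and> even c1
     then real p powr ((real b1 - 1) / 2) * (1 + leg (- a * c0) p)
     else real p powr ((real b1 - 1) / 2) * (1 + leg (- b0 * c0) p))"
proof -
  obtain t where t: "c1 = b1 + t"
    using b1_le_c1 by (auto simp: le_iff_add)
  \<comment> \<open>Here the letters give the parities of \<open>b1\<close> and
    \<open>c1\<close>.\<close>
  consider (ee) n k where "b1 = 2 * n" "t = 2 * k" | (eo) n k where "b1 = 2 * n" "t = Suc (2 * k)"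
    | (oe) n k where "b1 = Suc (2 * n)" "t = Suc (2 * k)" | (oo) n k where "b1 = Suc (2 * n)" "t = 2 * k"
    by (metis evenE oddE Suc_eq_plus1)
  then show ?thesis
  proof cases
    case ee
    have c1: "c1 = 2 * (n + k)"
      by (simp add: t ee)
    have P: "real p powr (real b1 / 2) = real p ^ n"
      by (rule powr_eq_power) (simp add: ee)
    \<comment> \<open>The number 0 is written with powers of \<open>p\<close> to fit the iteration
      rules.\<close>
    have "LD (int p ^ (2 * n) * (int p ^ (2 * k) * 0)) a (int p ^ (2 * n) * b0) (int p ^ (2 * n) * (int p ^ (2 * k) * c0))
        (real p ^ n * (real k * ((1 - 1 / real p) * (1 + leg (- a * b0) p)) + (1 + 1 / real p)))"
      using a b0 c0 by (intro LD_iterate2 LD_iterate_0 LD_contract_zero dens_descent_00)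
    then show ?thesis
      unfolding P by (rule LD_cong) (use p_pos in \<open>simp_all add: ee(1) c1 power_add mult_ac field_simps\<close>)
  next
    case eo
    have c1: "c1 = Suc (2 * (n + k))"
      by (simp add: t eo)
    have P: "real p powr (real b1 / 2) = real p ^ n"
      by (rule powr_eq_power) (simp add: eo)
    have "LD (int p ^ (2 * n) * (int p ^ (2 * k) * 0)) a (int p ^ (2 * n) * b0)
        (int p ^ (2 * n) * (int p ^ (2 * k) * (int p * c0)))
        (real p ^ n * (real k * ((1 - 1 / real p) * (1 + leg (- a * b0) p)) + (1 + leg (- a * b0) p)))"
      using a b0 c0 by (intro LD_iterate2 LD_iterate_0 LD_contract_zero dens_descent_01)
    then show ?thesis
      unfolding P by (rule LD_cong) (use p_pos in \<open>simp_all add: eo(1) c1 power_add mult_ac field_simps\<close>)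
  next
    case oe
    have c1: "c1 = 2 * Suc (n + k)"
      by (simp add: t oe)
    have P: "real p powr ((real b1 - 1) / 2) = real p ^ n"
      by (rule powr_eq_power) (simp add: oe)
    have "LD 0 a c0 (int p * b0) (1 + leg (- a * c0) p)"
      using a b0 c0 by (intro LD_contract_zero dens_descent_01)
    then have "LD (int p ^ (2 * n) * (int p ^ (2 * Suc k) * 0)) a (int p ^ (2 * n) * (int p * b0))
        (int p ^ (2 * n) * (int p ^ (2 * Suc k) * c0)) (real p ^ n * (1 + leg (- a * c0) p))"
      using a b0 by (intro LD_iterate2 LD_iterate_1) (simp_all add: LD_swap23)
    then show ?thesis
      unfolding P by (rule LD_cong) (use p_pos in \<open>simp_all add: oe(1) c1 power_add mult_ac\<close>)
  next
    case oo
    have c1: "c1 = Suc (2 * (n + k))"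
      by (simp add: t oo)
    have P: "real p powr ((real b1 - 1) / 2) = real p ^ n"
      by (rule powr_eq_power) (simp add: oo)
    have "LD (int p ^ (2 * n) * (int p ^ (2 * k) * 0)) a (int p ^ (2 * n) * (int p * b0))
        (int p ^ (2 * n) * (int p ^ (2 * k) * (int p * c0))) (real p ^ n * (1 + leg (- b0 * c0) p))"
      using a b0 c0 by (intro LD_iterate2 LD_iterate_1 LD_contract_zero dens_descent_11)
    then show ?thesis
      unfolding P by (rule LD_cong) (use p_pos in \<open>simp_all add: oo(1) c1 power_add mult_ac\<close>)
  qed
qed

end

end

theorem theorem1p3:
  fixes a b c b0 c0 :: int and b1 c1 p :: nat
  assumes "prime p" and "odd p"
    and "\<not> int p dvd a"
    and "b = b0 * int p ^ b1" and "c = c0 * int p ^ c1"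
    and "b1 \<le> c1"
    and "coprime b0 (int p)" and "coprime c0 (int p)"
  shows
    "(\<forall>(m::int) (m0::int) (m1::nat).
        m \<noteq> 0 \<and> m = m0 * int p ^ m1 \<and> coprime m0 (int p) \<longrightarrow>
        (m1 < b1 \<longrightarrow>
          has_local_density p m (diag_form a b c)
            (if even m1 then real p powr (real m1 / 2) * (1 + leg (a * m0) p) else 0)) \<and>
        (b1 \<le> m1 \<and> m1 < c1 \<longrightarrow>
          has_local_density p m (diag_form a b c)
            (if even b1
             then real p powr (real b1 / 2) *
                  (1 - 1 / real p * leg (- a * b0) p ^ (m1 + 1)
                   + (1 - 1 / real p) *
                     ((real m1 - real b1) / 2 + ((-1) ^ m1 - 1) / 4
                      + leg (- a * b0) p * ((real m1 - real b1) / 2 + (1 - (-1) ^ m1) / 4)))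
             else real p powr ((real b1 - 1) / 2) *
                  (1 + leg a p ^ (m1 + 1) * leg b0 p ^ m1 * leg m0 p))) \<and>
        (c1 \<le> m1 \<and> even b1 \<longrightarrow>
          has_local_density p m (diag_form a b c)
            (if even c1 \<and> even m1
             then real p powr (real b1 / 2) *
                  (1 + 1 / real p
                   + real p powr (- real m1 / 2 + real c1 / 2 - 1) * (leg (- a * b0 * c0 * m0) p - 1)
                   + (1 - 1 / real p) *
                     ((real c1 - real b1) / 2 + leg (- a * b0) p * ((real c1 - real b1) / 2)))
             else if even c1 \<and> odd m1
             then real p powr (real b1 / 2) *
                  ((1 + 1 / real p) * (1 - real p powr (- (real m1 + 1) / 2 + real c1 / 2))
                   + (1 - 1 / real p) *
                     ((real c1 - real b1) / 2 + leg (- a * b0) p * ((real c1 - real b1) / 2)))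
             else if odd c1 \<and> even m1
             then real p powr (real b1 / 2) *
                  (1 - real p powr (- real m1 / 2 + (real c1 - 1) / 2) * leg (- a * b0) p * (1 + 1 / real p)
                   + 1 / real p * leg (- a * b0) p
                   + (1 - 1 / real p) *
                     ((real c1 - real b1 - 1) / 2
                      + leg (- a * b0) p * ((real c1 - real b1 + 1) / 2)))
             else real p powr (real b1 / 2) *
                  (1 + real p powr (- (real m1 + 1) / 2 + (real c1 - 1) / 2)
                       * (leg (c0 * m0) p - leg (- a * b0) p)
                   + 1 / real p * leg (- a * b0) p
                   + (1 - 1 / real p) *
                     ((real c1 - real b1 - 1) / 2
                      + leg (- a * b0) p * ((real c1 - real b1 + 1) / 2))))) \<and>
        (c1 \<le> m1 \<and> odd b1 \<longrightarrow>
          has_local_density p m (diag_form a b c)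
            (if even c1 \<and> even m1
             then real p powr ((real b1 - 1) / 2) *
                  (1 + leg (- a * c0) p
                   - real p powr (- real m1 / 2 + real c1 / 2) * (1 + 1 / real p) * leg (- a * c0) p)
             else if even c1 \<and> odd m1
             then real p powr ((real b1 - 1) / 2) *
                  (1 + leg (- a * c0) p
                   + real p powr (- (real m1 + 1) / 2 + real c1 / 2)
                       * (leg (b0 * m0) p - leg (- a * c0) p))
             else if odd c1 \<and> even m1
             then real p powr ((real b1 - 1) / 2) *
                  (1 + leg (- b0 * c0) p
                   + real p powr (- real m1 / 2 + (real c1 - 1) / 2)
                       * (leg (a * m0) p - leg (- b0 * c0) p))
             else real p powr ((real b1 - 1) / 2) *
                  (1 + leg (- b0 * c0) p
                   - real p powr ((- real m1 + real c1) / 2) * (1 + 1 / real p) * leg (- b0 * c0) p)))) \<and>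
     has_local_density p 0 (diag_form a b c)
       (if even b1 \<and> even c1
        then real p powr (real b1 / 2) *
             (1 + 1 / real p
              + (1 - 1 / real p) *
                ((real c1 - real b1) / 2 + leg (- a * b0) p * ((real c1 - real b1) / 2)))
        else if even b1 \<and> odd c1
        then real p powr (real b1 / 2) *
             (1 + 1 / real p * leg (- a * b0) p
              + (1 - 1 / real p) *
                ((real c1 - real b1 - 1) / 2
                 + leg (- a * b0) p * ((real c1 - real b1 + 1) / 2)))
        else if odd b1 \<and> even c1
        then real p powr ((real b1 - 1) / 2) * (1 + leg (- a * c0) p)
        else real p powr ((real b1 - 1) / 2) * (1 + leg (- b0 * c0) p))"
proof -
  interpret odd_prime p
    using assms(1,2) by unfold_locales
  have b0: "\<not> int p dvd b0" and c0: "\<not> int p dvd c0"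
    using assms(7,8) by (simp_all add: coprime_p_iff)
  note units = assms(3) b0 c0 assms(6)
  show ?thesis
    unfolding assms(4,5)
  proof (intro conjI allI impI, goal_cases)
    case (1 m m0 m1)
    then show ?case
      using LD_below_b1[OF units, of m0 m1] by (auto simp only: coprime_p_iff)
  next
    case (2 m m0 m1)
    then show ?case
      using LD_between_b1_c1[OF units, of m0 m1] by (auto simp only: coprime_p_iff)
  next
    case (3 m m0 m1)
    then show ?case
      using LD_above_c1_even[OF units, of m0 m1] by (auto simp only: coprime_p_iff)
  next
    case (4 m m0 m1)
    then show ?case
      using LD_above_c1_odd[OF units, of m0 m1] by (auto simp only: coprime_p_iff)
  next
    case 5
    show ?case
      by (rule LD_at_zero[OF units])
  qed
qed

end
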